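(* Let $\theta\in\{0,1\}$ and let $\{(\mathbf{u}_h^n,\xi_h^n,\eta_h^n)\}_{n\ge0}$ be defined by the finite element algorithm (FEA) described in the context. Then $$J_{h,\theta}^\ell+S_{h,\theta}^\ell=J_{h,\theta}^0\qquad\text{for }\ell\ge1,\ \theta=0,1,$$ where $$J_{h,\theta}^\ell:=\frac12\Bigl[\mu\|\varepsilon(\mathbf{u}_h^{\ell+1})\|_{L^2(\Omega)}^2+\kappa_2\|\eta_h^{\ell+\theta}\|_{L^2(\Omega)}^2+\kappa_3\|\xi_h^{\ell+1}\|_{L^2(\Omega)}^2-2(\mathbf{f},\mathbf{u}_h^{\ell+1})-2\langle\mathbf{f}_1,\mathbf{u}_h^{\ell+1}\rangle\Bigr],$$ $$\begin{aligned}S_{h,\theta}^\ell:=\Delta t\sum_{n=1}^\ell\Bigl[&\frac{\mu\Delta t}{2}\|d_t\varepsilon(\mathbf{u}_h^{n+1})\|_{L^2(\Omega)}^2+\frac{K}{\mu_f}(\nabla p_h^{n+1}-\rho_f\mathbf{g},\nabla p_h^{n+1})+\frac{\kappa_2\Delta t}{2}\|d_t\eta_h^{n+\theta}\|_{L^2(\Omega)}^2\\&+\frac{\kappa_3\Delta t}{2}\|d_t\xi_h^{n+1}\|_{L^2(\Omega)}^2-(\phi,p_h^{n+1})-\langle\phi_1,p_h^{n+1}\rangle-(1-\theta)\frac{\kappa_1K\Delta t}{\mu_f}(d_t\nabla\xi_h^{n+1},\nabla p_h^{n+1})\Bigr],\end{aligned}$$ $$p_h^{n+1}:=\kappa_1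\xi_h^{n+1}+\kappa_2\eta_h^{n+\theta}.$$
   Context: Setting. $\Omega\subset\mathbb{R}^d$ ($d=2,3$) is a bounded polygonal domain; $(\cdot,\cdot)$ and $\langle\cdot,\cdot\rangle$ are the $L^2(\Omega)$ and $L^2(\partial\Omega)$ inner products; $\varepsilon(\mathbf{u})=\frac12(\nabla\mathbf{u}+\nabla\mathbf{u}^T)$; $\mathbf{RM}=\{\mathbf{a}+\mathbf{b}\times x:\mathbf{a},\mathbf{b}\in\mathbb{R}^d\}$ is the space of infinitesimal rigid motions (kernel of $\varepsilon$). Parameters: $\lambda,\mu,\alpha,\mu_f>0$, $c_0\ge0$, permeability $K$ (symmetric positive definite; written as a positive scalar constant factor in the claim), $\rho_f\not\equiv0$ and $\mathbf{g}$ given; $\kappa_1=\frac{\alpha}{\alpha^2+\lambda c_0}$, $\kappa_2=\frac{\lambda}{\alpha^2+\lambda c_0}$, $\kappa_3=\frac{c_0}{\alpha^2+\lambda c_0}$. Data, all independent of $t$: $\mathbf{f}\in\mathbf{L}^2(\Omega)$, $\mathbf{f}_1\in\mathbf{L}^2(\partial\Omega)$, $\phi\in L^2(\Omega)$, $\phi_1\in L^2(\partial\Omega)$, $\mathbf{u}_0\in\mathbf{H}^1(\Omega)$, $p_0\in L^2(\Omega)$, $q_0:=\operatorname{div}\mathbf{u}_0$, with $(\mathbf{f},\mathbf{v})+\langle\mathbf{f}_1,\mathbf{v}\rangle=0$ for all $\mathbf{v}\in\mathbf{RM}$. Finite element spaces. $\mathcal{T}_h$ is a quasi-uniform triangulation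 of $\Omega$ with mesh size $h$. Taylor–Hood element: $\mathbf{X}_h=\{\mathbf{v}_h\in\mathbf{C}^0(\overline\Omega):\mathbf{v}_h|_{\mathcal K}\in\mathbf{P}_2(\mathcal K)\ \forall\mathcal K\in\mathcal{T}_h\}$, $M_h=\{\varphi_h\in C^0(\overline\Omega):\varphi_h|_{\mathcal K}\in P_1(\mathcal K)\ \forall\mathcal K\in\mathcal{T}_h\}$, satisfying, uniformly in $h$, $\sup_{\mathbf{v}_h\in\mathbf{X}_h}\frac{(\operatorname{div}\mathbf{v}_h,\varphi_h)}{\|\nabla\mathbf{v}_h\|_{L^2(\Omega)}}\ge\beta_0\|\varphi_h\|_{L^2(\Omega)}$ for all $\varphi_h\in M_h\cap L^2_0(\Omega)$, $\beta_0>0$. $W_h=M_h$ and $\mathbf{V}_h=\{\mathbf{v}_h\in\mathbf{X}_h:(\mathbf{v}_h,\mathbf{r})=0\ \forall\mathbf{r}\in\mathbf{RM}\}$. $\mathcal{Q}_h$ is the $L^2$-projection onto $W_h$; $\mathcal{R}_h\mathbf{v}\in\mathbf{V}_h$ is defined by $(\varepsilon(\mathcal{R}_h\mathbf{v}),\varepsilon(\mathbf{w}_h))=(\varepsilon(\mathbf{v}),\varepsilon(\mathbf{w}_h))$ for all $\mathbf{w}_h\in\mathbf{V}_h$. Algorithm (FEA), with time step $\Delta t>0$, $d_tw^{n+1}=(w^{n+1}-w^n)/\Delta t$ for any sequence $w^n$, and $\theta\in\{0,1\}$. (i) $\mathbf{u}_h^0=\mathcal{R}_h\mathbf{u}_0$,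 $p_h^0=\mathcal{Q}_hp_0$, $q_h^0=\mathcal{Q}_hq_0$, $\eta_h^0=c_0p_h^0+\alpha q_h^0$, $\xi_h^0=\alpha p_h^0-\lambda q_h^0$. (ii) For $n=0,1,2,\dots$: find $(\mathbf{u}_h^{n+1},\xi_h^{n+1})\in\mathbf{V}_h\times W_h$ and $\eta_h^{n+1}\in W_h$ such that $\mu(\varepsilon(\mathbf{u}_h^{n+1}),\varepsilon(\mathbf{v}_h))-(\xi_h^{n+1},\operatorname{div}\mathbf{v}_h)=(\mathbf{f},\mathbf{v}_h)+\langle\mathbf{f}_1,\mathbf{v}_h\rangle$ for all $\mathbf{v}_h\in\mathbf{V}_h$; $\kappa_3(\xi_h^{n+1},\varphi_h)+(\operatorname{div}\mathbf{u}_h^{n+1},\varphi_h)=\kappa_1(\eta_h^{n+\theta},\varphi_h)$ for all $\varphi_h\in M_h$; $(d_t\eta_h^{n+1},\psi_h)+\frac1{\mu_f}(K(\nabla(\kappa_1\xi_h^{n+1}+\kappa_2\eta_h^{n+1})-\rho_f\mathbf{g}),\nabla\psi_h)=(\phi,\psi_h)+\langle\phi_1,\psi_h\rangle$ for all $\psi_h\in W_h$. Then $p_h^{n+1}=\kappa_1\xi_h^{n+1}+\kappa_2\eta_h^{n+\theta}$, $q_h^{n+1}=\kappa_1\eta_h^{n+1}-\kappa_3\xi_h^{n+1}$. *)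

theory Defs
  imports "HOL-Analysis.Analysis"
begin

section \<open>Square-integrable functions\<close>

definition square_integrable :: "'a measure \<Rightarrow> ('a \<Rightarrow> 'b::euclidean_space) \<Rightarrow> bool" where
  "square_integrable M f \<longleftrightarrow>
     f \<in> borel_measurable M \<and> integrable M (\<lambda>x. (norm (f x))\<^sup>2)"

definition L2_inner :: "'a measure \<Rightarrow> ('a \<Rightarrow> 'b::euclidean_space) \<Rightarrow> ('a \<Rightarrow> 'b) \<Rightarrow> real" where
  "L2_inner M f g = (\<integral>x. f x \<bullet> g x \<partial>M)"

definition L2_norm :: "'a measure \<Rightarrow> ('a \<Rightarrow> 'b::euclidean_space) \<Rightarrow> real" where
  "L2_norm M f = sqrt (L2_inner M f f)"


section \<open>Hausdorff measure and the surface measure on the boundary\<close>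

definition hausdorff_pre :: "nat \<Rightarrow> real \<Rightarrow> 'a::metric_space set \<Rightarrow> ennreal" where
  "hausdorff_pre s \<delta> A =
     (INF C \<in> {C :: nat \<Rightarrow> 'a set. A \<subseteq> (\<Union>i. C i) \<and> (\<forall>i. bounded (C i) \<and> diameter (C i) \<le> \<delta>)}.
        \<Sum>i. if C i = {} then 0 else ennreal (unit_ball_vol (real s) * (diameter (C i) / 2) ^ s))"

definition hausdorff_outer :: "nat \<Rightarrow> 'a::metric_space set \<Rightarrow> ennreal" where
  "hausdorff_outer s A = (SUP \<delta>\<in>{0<..}. hausdorff_pre s \<delta> A)"

definition hausdorff_measure :: "nat \<Rightarrow> 'a::metric_space measure" where
  "hausdorff_measure s = measure_of UNIV (sets borel) (hausdorff_outer s)"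

lemma hausdorff_pre_mono:
  assumes "A \<subseteq> B" shows "hausdorff_pre s \<delta> A \<le> hausdorff_pre s \<delta> B"
  unfolding hausdorff_pre_def by (rule INF_superset_mono) (use assms in auto)

lemma hausdorff_pre_antimono:
  assumes "\<delta> \<le> \<delta>'" shows "hausdorff_pre s \<delta>' A \<le> hausdorff_pre s \<delta> A"
  unfolding hausdorff_pre_def by (rule INF_superset_mono) (auto intro: order_trans[OF _ assms])

lemma hausdorff_pre_subadditive:
  "hausdorff_pre s \<delta> (\<Union>i. A i) \<le> (\<Sum>i::nat. hausdorff_pre s \<delta> (A i))"
proof (rule ennreal_le_epsilon)
  fix e :: real
  assume fin: "(\<Sum>i. hausdorff_pre s \<delta> (A i)) < top" and e: "0 < e"
  let ?v = "\<lambda>C :: 'a set. if C = {} then 0 else ennreal (unit_ball_vol (real s) * (diameter C / 2) ^ s)"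
  have finA: "hausdorff_pre s \<delta> (A i) < top" for i
    using fin by (metis ennreal_suminf_lessD)
  have "\<exists>C :: nat \<Rightarrow> 'a set. A i \<subseteq> (\<Union>k. C k) \<and> (\<forall>k. bounded (C k) \<and> diameter (C k) \<le> \<delta>) \<and>
          (\<Sum>k. ?v (C k)) \<le> hausdorff_pre s \<delta> (A i) + ennreal (e * (1/2) ^ Suc i)" for i
  proof -
    define b where "b = hausdorff_pre s \<delta> (A i) + ennreal (e * (1/2) ^ Suc i)"
    have "0 < ennreal (e * (1/2) ^ Suc i)" using e by simp
    then have "hausdorff_pre s \<delta> (A i) + 0 < b"
      unfolding b_def ennreal_add_left_cancel_less using finA[of i] by auto
    then have "hausdorff_pre s \<delta> (A i) < b" by simp
    then obtain C :: "nat \<Rightarrow> 'a set" where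
      "A i \<subseteq> (\<Union>k. C k)" "\<forall>k. bounded (C k) \<and> diameter (C k) \<le> \<delta>" "(\<Sum>k. ?v (C k)) < b"
      unfolding hausdorff_pre_def INF_less_iff by blast
    then show ?thesis
      unfolding b_def by (intro exI[of _ C]) auto
  qed
  then have "\<forall>i. \<exists>C :: nat \<Rightarrow> 'a set. A i \<subseteq> (\<Union>k. C k) \<and> (\<forall>k. bounded (C k) \<and> diameter (C k) \<le> \<delta>) \<and>
          (\<Sum>k. ?v (C k)) \<le> hausdorff_pre s \<delta> (A i) + ennreal (e * (1/2) ^ Suc i)" ..
  from choice[OF this] obtain C :: "nat \<Rightarrow> nat \<Rightarrow> 'a set" where
    C0: "\<forall>i. A i \<subseteq> (\<Union>k. C i k) \<and> (\<forall>k. bounded (C i k) \<and> diameter (C i k) \<le> \<delta>) \<and>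
       (\<Sum>k. ?v (C i k)) \<le> hausdorff_pre s \<delta> (A i) + ennreal (e * (1/2) ^ Suc i)" ..
  have C: "A i \<subseteq> (\<Union>k. C i k)" "bounded (C i k)" "diameter (C i k) \<le> \<delta>"
       "(\<Sum>k. ?v (C i k)) \<le> hausdorff_pre s \<delta> (A i) + ennreal (e * (1/2) ^ Suc i)" for i k
    using C0[rule_format, of i] by (auto simp del: UN_simps)
  define w where "w p = ?v (C (fst p) (snd p))" for p
  define D where "D n = (case prod_decode n of (i, k) \<Rightarrow> C i k)" for n
  have "(\<Union>i. A i) \<subseteq> (\<Union>n. D n)"
  proof
    fix x assume "x \<in> (\<Union>i. A i)"
    then obtain i k where "x \<in> C i k" using C(1) by blast
    then have "x \<in> D (prod_encode (i, k))" by (simp add: D_def)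
    then show "x \<in> (\<Union>n. D n)" by blast
  qed
  then have "hausdorff_pre s \<delta> (\<Union>i. A i) \<le> (\<Sum>n. ?v (D n))"
    unfolding hausdorff_pre_def
    by (intro INF_lower) (auto simp: D_def C split: prod.split)
  also have "(\<Sum>n. ?v (D n)) = (\<Sum>n. w (prod_decode n))"
    by (simp only: w_def D_def case_prod_beta)
  also have "\<dots> = (\<Sum>i. \<Sum>k. w (i, k))"
    by (rule suminf_ennreal_2dimen) (rule refl)
  also have "\<dots> = (\<Sum>i. \<Sum>k. ?v (C i k))"
    by (simp only: w_def fst_conv snd_conv)
  also have "\<dots> \<le> (\<Sum>i. hausdorff_pre s \<delta> (A i) + ennreal (e * (1/2) ^ Suc i))"
    by (intro suminf_le C(4)) auto
  also have "\<dots> = (\<Sum>i. hausdorff_pre s \<delta> (A i)) + (\<Sum>i. ennreal (e * (1/2) ^ Suc i))"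
    by (rule suminf_add[symmetric]) auto
  also have "(\<Sum>i. ennreal (e * (1/2) ^ Suc i)) = ennreal e"
  proof -
    have "(\<lambda>i. e * (1/2) ^ Suc i) sums (e * 1)"
      by (intro sums_mult power_half_series)
    then show ?thesis
      using e by (intro suminf_ennreal_eq) auto
  qed
  finally show "hausdorff_pre s \<delta> (\<Union>i. A i) \<le> (\<Sum>i. hausdorff_pre s \<delta> (A i)) + ennreal e" .
qed


lemma hausdorff_outer_mono: "A \<subseteq> B \<Longrightarrow> hausdorff_outer s A \<le> hausdorff_outer s B"
  unfolding hausdorff_outer_def by (intro SUP_mono) (blast intro: hausdorff_pre_mono)

lemma hausdorff_outer_subadditive: "hausdorff_outer s (\<Union>i. A i) \<le> (\<Sum>i::nat. hausdorff_outer s (A i))"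
  unfolding hausdorff_outer_def[of s "\<Union>i. A i"]
proof (rule SUP_least)
  fix \<delta> :: real assume "\<delta> \<in> {0<..}"
  then have "hausdorff_pre s \<delta> (A i) \<le> hausdorff_outer s (A i)" for i
    unfolding hausdorff_outer_def by (rule SUP_upper)
  then have "(\<Sum>i. hausdorff_pre s \<delta> (A i)) \<le> (\<Sum>i. hausdorff_outer s (A i))"
    by (intro suminf_le) auto
  then show "hausdorff_pre s \<delta> (\<Union>i. A i) \<le> (\<Sum>i. hausdorff_outer s (A i))"
    using hausdorff_pre_subadditive order_trans by blast
qed

lemma hausdorff_outer_space:
  "outer_measure_space (Pow UNIV) (hausdorff_outer s :: 'a::metric_space set \<Rightarrow> ennreal)"
  unfolding outer_measure_space_def
proof (intro conjI)
  let ?H = "hausdorff_outer s :: 'a set \<Rightarrow> ennreal"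
  show "increasing (Pow UNIV) ?H"
    by (auto simp: increasing_def intro: hausdorff_outer_mono)
  have "hausdorff_pre s \<delta> ({} :: 'a set) = 0" if "0 < \<delta>" for \<delta>
  proof -
    have "hausdorff_pre s \<delta> ({} :: 'a set) \<le> (\<Sum>i::nat. 0)"
      unfolding hausdorff_pre_def
      by (rule INF_lower2[where i = "\<lambda>_. {}"]) (use that in \<open>auto simp: diameter_def\<close>)
    then show ?thesis by simp
  qed
  then show "positive (Pow UNIV) ?H"
    by (simp add: positive_def hausdorff_outer_def)
  show "countably_subadditive (Pow UNIV) ?H"
    by (simp add: countably_subadditive_def hausdorff_outer_subadditive)
qed

lemma hausdorff_outer_empty: "hausdorff_outer s {} = 0"
  using hausdorff_outer_space by (auto simp: outer_measure_space_def positive_def)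

lemma hausdorff_outer_subadditive2: "hausdorff_outer s (A \<union> B) \<le> hausdorff_outer s A + hausdorff_outer s B"
proof -
  define C where "C i = (if i = 0 then A else if i = 1 then B else {})" for i :: nat
  have "A \<union> B = (\<Union>i. C i)"
    by (auto simp: C_def split: if_splits)
  then have "hausdorff_outer s (A \<union> B) \<le> (\<Sum>i. hausdorff_outer s (C i))"
    by (simp only: hausdorff_outer_subadditive)
  also have "\<dots> = (\<Sum>i\<in>{0, 1}. hausdorff_outer s (C i))"
    by (rule suminf_finite) (auto simp: C_def hausdorff_outer_empty)
  finally show ?thesis by (simp add: C_def)
qed

lemma hausdorff_outer_separated:
  assumes "0 < r" and sep: "\<And>a b. a \<in> A \<Longrightarrow> b \<in> B \<Longrightarrow> r \<le> dist a b"
  shows "hausdorff_outer s A + hausdorff_outer s B \<le> hausdorff_outer s (A \<union> B)"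
proof -
  let ?v = "\<lambda>C :: 'a set. if C = {} then 0 else ennreal (unit_ball_vol (real s) * (diameter C / 2) ^ s)"
  have pre: "hausdorff_pre s \<delta> A + hausdorff_pre s \<delta> B \<le> hausdorff_pre s \<delta> (A \<union> B)"
    if \<delta>: "0 < \<delta>" "\<delta> < r" for \<delta>
    unfolding hausdorff_pre_def[of s \<delta> "A \<union> B"]
  proof (rule INF_greatest)
    fix C :: "nat \<Rightarrow> 'a set"
    assume C: "C \<in> {C. A \<union> B \<subseteq> (\<Union>i. C i) \<and> (\<forall>i. bounded (C i) \<and> diameter (C i) \<le> \<delta>)}"
    define CA where "CA i = (if C i \<inter> A = {} then {} else C i)" for i
    define CB where "CB i = (if C i \<inter> B = {} then {} else C i)" for i
    have "hausdorff_pre s \<delta> A \<le> (\<Sum>i. ?v (CA i))" "hausdorff_pre s \<delta> B \<le> (\<Sum>i. ?v (CB i))"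
      unfolding hausdorff_pre_def
    proof -
      have sub: "A \<subseteq> (\<Union>i. CA i)" "B \<subseteq> (\<Union>i. CB i)"
        using C by (fastforce simp: CA_def CB_def)+
      have "bounded (CA i) \<and> diameter (CA i) \<le> \<delta>" "bounded (CB i) \<and> diameter (CB i) \<le> \<delta>" for i
        using C \<delta> by (auto simp: CA_def CB_def)
      with sub show "(INF C \<in> {C. A \<subseteq> (\<Union>i. C i) \<and> (\<forall>i. bounded (C i) \<and> diameter (C i) \<le> \<delta>)}. \<Sum>i. ?v (C i))
            \<le> (\<Sum>i. ?v (CA i))"
        "(INF C \<in> {C. B \<subseteq> (\<Union>i. C i) \<and> (\<forall>i. bounded (C i) \<and> diameter (C i) \<le> \<delta>)}. \<Sum>i. ?v (C i))
            \<le> (\<Sum>i. ?v (CB i))"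
        by (auto intro!: INF_lower)
    qed
    then have "hausdorff_pre s \<delta> A + hausdorff_pre s \<delta> B \<le> (\<Sum>i. ?v (CA i)) + (\<Sum>i. ?v (CB i))"
      by (rule add_mono)
    also have "\<dots> = (\<Sum>i. ?v (CA i) + ?v (CB i))"
      by (rule suminf_add) auto
    also have "\<dots> \<le> (\<Sum>i. ?v (C i))"
    proof (intro suminf_le)
      fix i
      have "CA i = {} \<or> CB i = {}"
      proof (rule ccontr)
        assume "\<not> ?thesis"
        then obtain a b where ab: "a \<in> C i" "a \<in> A" "b \<in> C i" "b \<in> B"
          unfolding CA_def CB_def by (auto split: if_splits)
        then have "dist a b \<le> \<delta>"
          using C diameter_bounded_bound[of "C i" a b] by (auto intro: order_trans)
        with sep[OF ab(2,4)] \<delta> show False by simp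
      qed
      then show "?v (CA i) + ?v (CB i) \<le> ?v (C i)"
        by (auto simp: CA_def CB_def split: if_splits)
    qed auto
    finally show "hausdorff_pre s \<delta> A + hausdorff_pre s \<delta> B \<le> (\<Sum>i. ?v (C i))" .
  qed
  have "hausdorff_pre s \<delta>1 A + hausdorff_pre s \<delta>2 B \<le> hausdorff_outer s (A \<union> B)"
    if "0 < \<delta>1" "0 < \<delta>2" for \<delta>1 \<delta>2
  proof -
    define \<delta> where "\<delta> = min (min \<delta>1 \<delta>2) (r / 2)"
    have \<delta>: "0 < \<delta>" "\<delta> < r" "\<delta> \<le> \<delta>1" "\<delta> \<le> \<delta>2" using that \<open>0 < r\<close> by (auto simp: \<delta>_def)
    have "hausdorff_pre s \<delta>1 A + hausdorff_pre s \<delta>2 B \<le> hausdorff_pre s \<delta> A + hausdorff_pre s \<delta> B"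
      using \<delta> by (intro add_mono hausdorff_pre_antimono)
    also have "\<dots> \<le> hausdorff_pre s \<delta> (A \<union> B)" by (rule pre) (use \<delta> in auto)
    also have "\<dots> \<le> hausdorff_outer s (A \<union> B)"
      unfolding hausdorff_outer_def using \<delta> by (intro SUP_upper) auto
    finally show ?thesis .
  qed
  then have 1: "hausdorff_pre s \<delta>1 A + hausdorff_outer s B \<le> hausdorff_outer s (A \<union> B)" if "0 < \<delta>1" for \<delta>1
    using that unfolding hausdorff_outer_def[of s B]
    by (subst ennreal_SUP_add_right) (auto intro!: SUP_least)
  then show ?thesis
    unfolding hausdorff_outer_def[of s A]
    by (subst ennreal_SUP_add_left[symmetric]) (auto intro!: SUP_least)
qed

lemma hausdorff_outer_separated_sum:
  fixes R :: "nat \<Rightarrow> 'a::metric_space set"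
  assumes sep: "\<And>j. \<exists>r>0. \<forall>k>j. \<forall>a\<in>R j. \<forall>b\<in>R k. r \<le> dist a b"
  shows "(\<Sum>j<n. hausdorff_outer s (R j)) \<le> hausdorff_outer s (\<Union>j<n. R j)"
proof (induction n)
  case 0
  show ?case by simp
next
  case (Suc n)
  obtain r where r: "\<And>j. 0 < r j" "\<And>j k a b. j < k \<Longrightarrow> a \<in> R j \<Longrightarrow> b \<in> R k \<Longrightarrow> r j \<le> dist a b"
    using sep by metis
  define q where "q = Min (insert 1 (r ` {..<n}))"
  have "0 < q" unfolding q_def using r(1) by (subst Min_gr_iff) auto
  have "q \<le> dist a b" if ab: "a \<in> (\<Union>j<n. R j)" "b \<in> R n" for a b
  proof -
    obtain j where j: "j < n" "a \<in> R j" using ab(1) by blast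
    then have "q \<le> r j" unfolding q_def by (intro Min_le) auto
    with r(2)[OF j(1) j(2) ab(2)] show ?thesis by simp
  qed
  then have "hausdorff_outer s (\<Union>j<n. R j) + hausdorff_outer s (R n)
      \<le> hausdorff_outer s ((\<Union>j<n. R j) \<union> R n)"
    by (intro hausdorff_outer_separated[OF \<open>0 < q\<close>]) auto
  moreover have "(\<Union>j<n. R j) \<union> R n = (\<Union>j<Suc n. R j)"
    by (auto simp: lessThan_Suc)
  ultimately have "hausdorff_outer s (\<Union>j<n. R j) + hausdorff_outer s (R n) \<le> hausdorff_outer s (\<Union>j<Suc n. R j)"
    by simp
  then show ?case using Suc.IH by (auto intro: order_trans[OF add_right_mono])
qed

lemma hausdorff_outer_closed:
  fixes F E :: "'a::metric_space set"
  assumes F: "closed F"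
  shows "hausdorff_outer s (E \<inter> F) + hausdorff_outer s (E - F) = hausdorff_outer s E"
proof (rule antisym)
  let ?H = "hausdorff_outer s :: 'a set \<Rightarrow> ennreal"
  have "E = (E \<inter> F) \<union> (E - F)" by blast
  then show "?H E \<le> ?H (E \<inter> F) + ?H (E - F)"
    using hausdorff_outer_subadditive2 by metis
  show "?H (E \<inter> F) + ?H (E - F) \<le> ?H E"
  proof (cases "F = {} \<or> ?H E = top")
    case True
    then show ?thesis by (auto simp: hausdorff_outer_empty)
  next
    case False
    then have ne: "F \<noteq> {}" and fin: "?H E < top" by (auto simp: less_top)
    define D where "D n = {x \<in> E. 1 / real (Suc n) \<le> infdist x F}" for n
    define R where "R n = D (Suc n) - D n" for n
    have DE: "D n \<subseteq> E" for n by (auto simp: D_def)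
    have Dmono: "D n \<subseteq> D m" if "n \<le> m" for n m
    proof -
      have "1 / real (Suc m) \<le> 1 / real (Suc n)" using that by (simp add: frac_le)
      then show ?thesis by (auto simp: D_def)
    qed
    have sepR: "\<exists>r>0. \<forall>k\<ge>j+2. \<forall>a\<in>R j. \<forall>b\<in>R k. r \<le> dist a b" for j
    proof (intro exI conjI allI impI ballI)
      show "0 < 1 / real (j + 2) - 1 / real (j + 3)" by (simp add: frac_less2)
      fix k a b assume k: "j + 2 \<le> k" and a: "a \<in> R j" and b: "b \<in> R k"
      have "1 / real (j + 2) \<le> infdist a F" using a by (simp add: R_def D_def add.commute)
      moreover have "infdist b F < 1 / real (Suc k)" using b DE by (auto simp: R_def D_def)
      moreover have "1 / real (Suc k) \<le> 1 / real (j + 3)" using k by (intro divide_left_mono) auto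
      moreover have "infdist a F \<le> infdist b F + dist a b" by (rule infdist_triangle)
      ultimately show "1 / real (j + 2) - 1 / real (j + 3) \<le> dist a b" by linarith
    qed
    have half: "(\<Sum>i<n. ?H (R (2 * i + c))) \<le> ?H E" for n c
    proof -
      have "\<exists>r>0. \<forall>k>j. \<forall>a\<in>R (2 * j + c). \<forall>b\<in>R (2 * k + c). r \<le> dist a b" for j
      proof -
        obtain r where r: "0 < r" "\<And>k a b. 2 * j + c + 2 \<le> k \<Longrightarrow> a \<in> R (2 * j + c) \<Longrightarrow> b \<in> R k \<Longrightarrow> r \<le> dist a b"
          using sepR[of "2 * j + c"] by blast
        have "r \<le> dist a b" if "j < k" "a \<in> R (2 * j + c)" "b \<in> R (2 * k + c)" for k a b
          by (rule r(2)[OF _ that(2,3)]) (use that(1) in auto)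
        then show ?thesis using r(1) by blast
      qed
      then have "(\<Sum>i<n. ?H (R (2 * i + c))) \<le> ?H (\<Union>i<n. R (2 * i + c))"
        by (rule hausdorff_outer_separated_sum)
      also have "\<dots> \<le> ?H E" by (rule hausdorff_outer_mono) (use DE in \<open>auto simp: R_def\<close>)
      finally show ?thesis .
    qed
    have "(\<Sum>i<n. ?H (R i)) \<le> ?H E + ?H E" for n
    proof -
      have "(\<Sum>i<n. ?H (R i)) \<le> (\<Sum>i<2 * n. ?H (R i))"
        by (rule sum_mono2) auto
      also have "\<dots> = (\<Sum>i<n. ?H (R (2 * i + 0))) + (\<Sum>i<n. ?H (R (2 * i + 1)))"
        by (induction n) (auto simp: ac_simps)
      also have "\<dots> \<le> ?H E + ?H E" by (intro add_mono half)
      finally show ?thesis .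
    qed
    then have "(\<Sum>i. ?H (R i)) \<le> ?H E + ?H E"
      unfolding suminf_eq_SUP by (rule SUP_least)
    also have "\<dots> < top" using fin by (simp add: less_top[symmetric])
    finally have finR: "(\<Sum>i. ?H (R i)) < top" .
    have tail: "(\<lambda>n. \<Sum>i. ?H (R (i + n))) \<longlonglongrightarrow> 0"
    proof -
      define a where "a i = enn2real (?H (R i))" for i
      have a: "?H (R i) = ennreal (a i)" for i
        using finR ennreal_suminf_lessD[OF finR, of i] by (simp add: a_def)
      have a0: "0 \<le> a i" for i by (simp add: a_def)
      have "summable a"
        by (rule summable_suminf_not_top) (use a0 finR in \<open>auto simp: a\<close>)
      then have "(\<lambda>n. \<Sum>i. a (i + n)) \<longlonglongrightarrow> 0" by (rule suminf_exist_split2)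
      then have "(\<lambda>n. ennreal (\<Sum>i. a (i + n))) \<longlonglongrightarrow> ennreal 0" by (rule tendsto_ennrealI)
      moreover have "(\<Sum>i. ?H (R (i + n))) = ennreal (\<Sum>i. a (i + n))" for n
        unfolding a using a0 \<open>summable a\<close>
        by (intro suminf_ennreal2) (auto simp: summable_iff_shift)
      ultimately show ?thesis by simp
    qed
    have bound: "?H (E \<inter> F) + ?H (E - F) \<le> ?H E + (\<Sum>i. ?H (R (i + n)))" for n
    proof -
      have "E - F \<subseteq> D n \<union> (\<Union>i. R (i + n))"
      proof
        fix x assume x: "x \<in> E - F"
        then have "0 < infdist x F"
          using F ne infdist_pos_not_in_closed by auto
        then obtain m where "inverse (real (Suc m)) < infdist x F" using reals_Archimedean by blast
        then have "x \<in> D m" using x by (simp add: D_def inverse_eq_divide)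
        then have ex: "\<exists>m. x \<in> D m" ..
        define l where "l = (LEAST m. x \<in> D m)"
        have l: "x \<in> D l" unfolding l_def using ex by (rule LeastI_ex)
        show "x \<in> D n \<union> (\<Union>i. R (i + n))"
        proof (cases "l \<le> n")
          case True
          then show ?thesis using l Dmono by blast
        next
          case False
          then obtain k where k: "l = Suc k" "n \<le> k" by (cases l) auto
          have "x \<notin> D k" using not_less_Least[of k "\<lambda>m. x \<in> D m"] k by (auto simp: l_def)
          then have "x \<in> R ((k - n) + n)" using l k by (simp add: R_def)
          then show ?thesis by blast
        qed
      qed
      then have "?H (E - F) \<le> ?H (D n \<union> (\<Union>i. R (i + n)))" by (rule hausdorff_outer_mono)
      also have "\<dots> \<le> ?H (D n) + (\<Sum>i. ?H (R (i + n)))"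
        by (rule order_trans[OF hausdorff_outer_subadditive2 add_left_mono[OF hausdorff_outer_subadditive]])
      finally have "?H (E \<inter> F) + ?H (E - F) \<le> (?H (E \<inter> F) + ?H (D n)) + (\<Sum>i. ?H (R (i + n)))"
        by (simp add: add.assoc add_left_mono)
      moreover have "?H (E \<inter> F) + ?H (D n) \<le> ?H ((E \<inter> F) \<union> D n)"
      proof (rule hausdorff_outer_separated)
        show "0 < 1 / real (Suc n)" by simp
        fix a b assume "a \<in> E \<inter> F" "b \<in> D n"
        then show "1 / real (Suc n) \<le> dist a b"
          using infdist_le[of a F b] by (auto simp: D_def dist_commute)
      qed
      moreover have "?H ((E \<inter> F) \<union> D n) \<le> ?H E"
        by (rule hausdorff_outer_mono) (use DE in auto)
      ultimately show ?thesis
        by (meson add_right_mono order_trans)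
    qed
    have "(\<lambda>n. ?H E + (\<Sum>i. ?H (R (i + n)))) \<longlonglongrightarrow> ?H E + 0"
      by (intro tendsto_add tendsto_const tail)
    then show ?thesis
      using bound by (intro LIMSEQ_le_const[of _ "?H E"]) auto
  qed
qed

theorem measure_space_hausdorff: "measure_space UNIV (sets borel) (hausdorff_outer s)"
proof -
  define L where "L = lambda_system UNIV (Pow UNIV) (hausdorff_outer s :: 'a::metric_space set \<Rightarrow> ennreal)"
  have L: "measure_space UNIV L (hausdorff_outer s)"
    unfolding L_def by (rule sigma_algebra.caratheodory_lemma[OF sigma_algebra_Pow hausdorff_outer_space])
  then interpret L: sigma_algebra UNIV L by (simp add: measure_space_def)
  have "Collect closed \<subseteq> L"
    using hausdorff_outer_closed[where 'a = 'a]
    unfolding L_def algebra.lambda_system_eq[OF algebra_Pow] by auto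
  then have "sets (borel :: 'a measure) \<subseteq> L"
    unfolding borel_eq_closed by (simp add: L.sigma_sets_subset)
  moreover have "sigma_algebra UNIV (sets (borel :: 'a measure))"
    using sets.sigma_algebra_axioms[of "borel :: 'a measure"] by simp
  ultimately show ?thesis
    using L by (auto simp: measure_space_def countably_additive_def positive_def dest: subset_trans)
qed

theorem emeasure_hausdorff_measure:
  "A \<in> sets borel \<Longrightarrow> emeasure (hausdorff_measure s) A = hausdorff_outer s A"
  using measure_space_hausdorff[of s] unfolding measure_space_def hausdorff_measure_def
  by (intro emeasure_measure_of_sigma) auto

text \<open>By \<open>emeasure_hausdorff_measure\<close> this is the \<open>(d - 1)\<close>-dimensional Hausdorff measure,
  restricted to the boundary; the factor \<open>unit_ball_vol s / 2 ^ s\<close> normalises it to surface area.\<close>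

definition surface_measure :: "(real^'d) set \<Rightarrow> (real^'d) measure" where
  "surface_measure \<Omega> = restrict_space (hausdorff_measure (CARD('d) - 1)) (frontier \<Omega>)"


section \<open>Domains and triangulations\<close>

text \<open>Taking the interior of a union of polytopes excludes slits and removed null sets.\<close>

definition polygonal_domain :: "(real^'d) set \<Rightarrow> bool" where
  "polygonal_domain \<Omega> \<longleftrightarrow>
     \<Omega> \<noteq> {} \<and> connected \<Omega> \<and>
     (\<exists>P. finite P \<and> (\<forall>K\<in>P. polytope K) \<and> \<Omega> = interior (\<Union>P))"

definition mesh :: "(real^'d) set \<Rightarrow> real \<Rightarrow> (real^'d) set set \<Rightarrow> bool" where
  "mesh \<Omega> h \<T> \<longleftrightarrow>
     triangulation \<T> \<and> (\<forall>K\<in>\<T>. int CARD('d) simplex K) \<and> \<Union>\<T> = closure \<Omega> \<and>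
     h = Max (diameter ` \<T>)"

text \<open>Both shape regularity and comparability of the element sizes, uniformly over the family.\<close>

definition quasi_uniform :: "real set \<Rightarrow> (real \<Rightarrow> (real^'d) set set) \<Rightarrow> bool" where
  "quasi_uniform H \<T> \<longleftrightarrow>
     (\<exists>c>0. \<forall>h\<in>H. \<forall>K\<in>\<T> h. \<exists>x. cball x (c * h) \<subseteq> K)"


section \<open>Differential operators\<close>

text \<open>The operators below are classical. Finite element functions are differentiable in the
  interior of every mesh element, that is, off a null set, and there the classical derivative is
  the weak one.\<close>

definition grad :: "(real^'d \<Rightarrow> real) \<Rightarrow> real^'d \<Rightarrow> real^'d" where
  "grad w x = (\<chi> j. frechet_derivative w (at x) (axis j 1))"

definition jac :: "(real^'d \<Rightarrow> real^'d) \<Rightarrow> real^'d \<Rightarrow> real^'d^'d" where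
  "jac u x = jacobian u (at x)"

definition sym_part :: "real^'d^'d \<Rightarrow> real^'d^'d" where
  "sym_part A = (1/2) *\<^sub>R (A + transpose A)"

definition strain :: "(real^'d \<Rightarrow> real^'d) \<Rightarrow> real^'d \<Rightarrow> real^'d^'d" where
  "strain u x = sym_part (jac u x)"

definition divergence :: "(real^'d \<Rightarrow> real^'d) \<Rightarrow> real^'d \<Rightarrow> real" where
  "divergence u x = trace (jac u x)"

primrec C_k :: "nat \<Rightarrow> (real^'d \<Rightarrow> real) \<Rightarrow> bool" where
  "C_k 0 \<psi> \<longleftrightarrow> continuous_on UNIV \<psi>"
| "C_k (Suc k) \<psi> \<longleftrightarrow>
     \<psi> differentiable_on UNIV \<and> (\<forall>v. C_k k (\<lambda>x. frechet_derivative \<psi> (at x) v))"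

definition test_functions :: "(real^'d) set \<Rightarrow> (real^'d \<Rightarrow> real) set" where
  "test_functions \<Omega> =
     {\<psi>. (\<forall>k. C_k k \<psi>) \<and> (\<exists>S. compact S \<and> S \<subseteq> \<Omega> \<and> (\<forall>x. x \<notin> S \<longrightarrow> \<psi> x = 0))}"

text \<open>\<open>H1_jacobian \<Omega> u G\<close>: \<open>u\<close> belongs to \<open>H\<^sup>1(\<Omega>)\<^sup>d\<close> and \<open>G\<close> is its weak Jacobian,
  \<open>G\<^sub>i\<^sub>j = \<partial>\<^sub>j u\<^sub>i\<close>.\<close>

definition H1_jacobian :: "(real^'d) set \<Rightarrow> (real^'d \<Rightarrow> real^'d) \<Rightarrow> (real^'d \<Rightarrow> real^'d^'d) \<Rightarrow> bool" where
  "H1_jacobian \<Omega> u G \<longleftrightarrow>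
     square_integrable (lebesgue_on \<Omega>) u \<and> square_integrable (lebesgue_on \<Omega>) G \<and>
     (\<forall>\<psi>\<in>test_functions \<Omega>. \<forall>i j.
        (\<integral>x. u x $ i * grad \<psi> x $ j \<partial>lebesgue_on \<Omega>)
          = - (\<integral>x. G x $ i $ j * \<psi> x \<partial>lebesgue_on \<Omega>))"


section \<open>Infinitesimal rigid motions\<close>

text \<open>In every dimension \<open>b \<times> x\<close> is read as the action of a skew-symmetric matrix; the next two
  lemmas give the usual forms for dimensions 3 and 2.\<close>

definition rigid_motions :: "(real^'d \<Rightarrow> real^'d) set" where
  "rigid_motions = {\<lambda>x. a + B *v x | a B. transpose B = - B}"

lemma rigid_motions_3: "rigid_motions = {\<lambda>x. a + cross3 b x | a b. True}"
proof -
  have "\<exists>b. \<forall>x. B *v x = cross3 b x" if B: "transpose B = - B" for B :: "real^3^3"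
  proof
    have e: "B $ j $ i = - B $ i $ j" for i j
      using arg_cong[OF B, of "\<lambda>M. M $ i $ j"] by (simp add: transpose_def)
    show "\<forall>x. B *v x = cross3 (vector [B $ 3 $ 2, B $ 1 $ 3, B $ 2 $ 1]) x"
      using e[of 1 1] e[of 2 2] e[of 3 3] e[of 1 2] e[of 1 3] e[of 2 3]
      by (simp add: vec_eq_iff forall_3 cross3_def matrix_vector_mult_def sum_3 vector_def algebra_simps)
  qed
  moreover have "\<exists>B. transpose B = - B \<and> (\<forall>x. B *v x = cross3 b x)" for b :: "real^3"
    by (rule exI[of _ "vector [vector [0, - b $ 3, b $ 2], vector [b $ 3, 0, - b $ 1], vector [- b $ 2, b $ 1, 0]]"])
       (simp add: vec_eq_iff forall_3 cross3_def matrix_vector_mult_def sum_3 vector_def transpose_def algebra_simps)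
  ultimately show ?thesis
    unfolding rigid_motions_def by (auto; metis)
qed

lemma rigid_motions_2: "rigid_motions = {\<lambda>x. a + b *\<^sub>R vector [- x $ 2, x $ 1] | (a :: real^2) b. True}"
proof -
  have "\<exists>b. \<forall>x. B *v x = b *\<^sub>R vector [- x $ 2, x $ 1]" if B: "transpose B = - B" for B :: "real^2^2"
  proof
    have e: "B $ j $ i = - B $ i $ j" for i j
      using arg_cong[OF B, of "\<lambda>M. M $ i $ j"] by (simp add: transpose_def)
    show "\<forall>x. B *v x = (B $ 2 $ 1) *\<^sub>R vector [- x $ 2, x $ 1]"
      using e[of 1 1] e[of 2 2] e[of 1 2]
      by (simp add: vec_eq_iff forall_2 matrix_vector_mult_def sum_2 vector_def algebra_simps)
  qed
  moreover have "\<exists>B :: real^2^2. transpose B = - B \<and> (\<forall>x. B *v x = b *\<^sub>R vector [- x $ 2, x $ 1])" for b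
    by (rule exI[of _ "vector [vector [0, - b], vector [b, 0]]"])
       (simp add: vec_eq_iff forall_2 matrix_vector_mult_def sum_2 vector_def transpose_def algebra_simps)
  ultimately show ?thesis
    unfolding rigid_motions_def by (auto; metis)
qed


section \<open>Taylor--Hood finite element spaces\<close>

text \<open>All functions are total; finite element functions are unconstrained outside the closure
  of the domain, and nothing below depends on their values there.\<close>

definition polynomial_le :: "nat \<Rightarrow> (real^'d \<Rightarrow> real) \<Rightarrow> bool" where
  "polynomial_le k p \<longleftrightarrow>
     (\<exists>c. \<forall>x. p x = (\<Sum>a\<in>{a :: 'd \<Rightarrow> nat. sum a UNIV \<le> k}. c a * (\<Prod>i\<in>UNIV. x $ i ^ a i)))"

definition P_on :: "nat \<Rightarrow> (real^'d) set \<Rightarrow> (real^'d \<Rightarrow> real) \<Rightarrow> bool" where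
  "P_on k K v \<longleftrightarrow> (\<exists>p. polynomial_le k p \<and> (\<forall>x\<in>K. v x = p x))"

definition X_h :: "(real^'d) set \<Rightarrow> (real^'d) set set \<Rightarrow> (real^'d \<Rightarrow> real^'d) set" where
  "X_h \<Omega> \<T> = {v. continuous_on (closure \<Omega>) v \<and> (\<forall>K\<in>\<T>. \<forall>i. P_on 2 K (\<lambda>x. v x $ i))}"

definition M_h :: "(real^'d) set \<Rightarrow> (real^'d) set set \<Rightarrow> (real^'d \<Rightarrow> real) set" where
  "M_h \<Omega> \<T> = {\<phi>. continuous_on (closure \<Omega>) \<phi> \<and> (\<forall>K\<in>\<T>. P_on 1 K \<phi>)}"

abbreviation W_h :: "(real^'d) set \<Rightarrow> (real^'d) set set \<Rightarrow> (real^'d \<Rightarrow> real) set" where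
  "W_h \<equiv> M_h"

definition V_h :: "(real^'d) set \<Rightarrow> (real^'d) set set \<Rightarrow> (real^'d \<Rightarrow> real^'d) set" where
  "V_h \<Omega> \<T> = {v \<in> X_h \<Omega> \<T>. \<forall>r\<in>rigid_motions. L2_inner (lebesgue_on \<Omega>) v r = 0}"

text \<open>Velocities with vanishing gradient norm, for which the quotient is undefined, are left out
  of the supremum.\<close>

definition inf_sup_stable :: "(real^'d) set \<Rightarrow> (real^'d) set set \<Rightarrow> real \<Rightarrow> bool" where
  "inf_sup_stable \<Omega> \<T> \<beta>\<^sub>0 \<longleftrightarrow>
     (\<forall>\<phi>\<in>M_h \<Omega> \<T>. (\<integral>x. \<phi> x \<partial>lebesgue_on \<Omega>) = 0 \<longrightarrow>
        (SUP v\<in>{v \<in> X_h \<Omega> \<T>. L2_norm (lebesgue_on \<Omega>) (jac v) \<noteq> 0}.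
           L2_inner (lebesgue_on \<Omega>) (divergence v) \<phi> / L2_norm (lebesgue_on \<Omega>) (jac v))
        \<ge> \<beta>\<^sub>0 * L2_norm (lebesgue_on \<Omega>) \<phi>)"

definition is_L2_projection ::
  "(real^'d) set \<Rightarrow> (real^'d \<Rightarrow> real) set \<Rightarrow> (real^'d \<Rightarrow> real) \<Rightarrow> (real^'d \<Rightarrow> real) \<Rightarrow> bool" where
  "is_L2_projection \<Omega> W w wh \<longleftrightarrow>
     wh \<in> W \<and> (\<forall>\<phi>\<in>W. L2_inner (lebesgue_on \<Omega>) wh \<phi> = L2_inner (lebesgue_on \<Omega>) w \<phi>)"

text \<open>The projected function enters only through its weak Jacobian \<open>G\<close>.\<close>

definition is_elastic_projection ::
  "(real^'d) set \<Rightarrow> (real^'d \<Rightarrow> real^'d) set \<Rightarrow> (real^'d \<Rightarrow> real^'d^'d) \<Rightarrow> (real^'d \<Rightarrow> real^'d) \<Rightarrow> bool" where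
  "is_elastic_projection \<Omega> V G vh \<longleftrightarrow>
     vh \<in> V \<and> (\<forall>w\<in>V. L2_inner (lebesgue_on \<Omega>) (strain vh) (strain w)
                     = L2_inner (lebesgue_on \<Omega>) (\<lambda>x. sym_part (G x)) (strain w))"


section \<open>Discrete energy law\<close>

text \<open>\<open>d_t \<tau> w m\<close> is the difference quotient at level \<open>m\<close>; it is meaningful, and used, for
  \<open>m \<ge> 1\<close> only.\<close>

definition d_t :: "real \<Rightarrow> (nat \<Rightarrow> 'a \<Rightarrow> 'b::real_vector) \<Rightarrow> nat \<Rightarrow> 'a \<Rightarrow> 'b" where
  "d_t \<tau> w m x = (w m x - w (m - 1) x) /\<^sub>R \<tau>"

definition J_h ::
  "(real^'d) set \<Rightarrow> real \<Rightarrow> real \<Rightarrow> real \<Rightarrow> (real^'d \<Rightarrow> real^'d) \<Rightarrow> (real^'d \<Rightarrow> real^'d) \<Rightarrow> nat \<Rightarrow>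
   (nat \<Rightarrow> real^'d \<Rightarrow> real^'d) \<Rightarrow> (nat \<Rightarrow> real^'d \<Rightarrow> real) \<Rightarrow> (nat \<Rightarrow> real^'d \<Rightarrow> real) \<Rightarrow> nat \<Rightarrow> real" where
  "J_h \<Omega> \<mu> \<kappa>\<^sub>2 \<kappa>\<^sub>3 f f\<^sub>1 \<theta> u \<xi> \<eta> l =
     1/2 * (\<mu> * (L2_norm (lebesgue_on \<Omega>) (strain (u (l + 1))))\<^sup>2
          + \<kappa>\<^sub>2 * (L2_norm (lebesgue_on \<Omega>) (\<eta> (l + \<theta>)))\<^sup>2
          + \<kappa>\<^sub>3 * (L2_norm (lebesgue_on \<Omega>) (\<xi> (l + 1)))\<^sup>2
          - 2 * L2_inner (lebesgue_on \<Omega>) f (u (l + 1))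
          - 2 * L2_inner (surface_measure \<Omega>) f\<^sub>1 (u (l + 1)))"

text \<open>The permeability is a matrix, applied inside the inner products; by
  \<open>L2_inner_scalar_permeability\<close> a scalar permeability comes out as a constant factor.\<close>

definition S_h ::
  "(real^'d) set \<Rightarrow> real \<Rightarrow> real \<Rightarrow> real \<Rightarrow> real \<Rightarrow> real^'d^'d \<Rightarrow> real \<Rightarrow> (real^'d \<Rightarrow> real) \<Rightarrow>
   (real^'d \<Rightarrow> real^'d) \<Rightarrow> (real^'d \<Rightarrow> real) \<Rightarrow> (real^'d \<Rightarrow> real) \<Rightarrow> real \<Rightarrow> nat \<Rightarrow>
   (nat \<Rightarrow> real^'d \<Rightarrow> real^'d) \<Rightarrow> (nat \<Rightarrow> real^'d \<Rightarrow> real) \<Rightarrow> (nat \<Rightarrow> real^'d \<Rightarrow> real) \<Rightarrow> nat \<Rightarrow> real" where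
  "S_h \<Omega> \<mu> \<kappa>\<^sub>1 \<kappa>\<^sub>2 \<kappa>\<^sub>3 K \<mu>\<^sub>f \<rho>\<^sub>f g \<phi> \<phi>\<^sub>1 \<tau> \<theta> u \<xi> \<eta> l =
     (let p = (\<lambda>n x. \<kappa>\<^sub>1 * \<xi> (n + 1) x + \<kappa>\<^sub>2 * \<eta> (n + \<theta>) x) \<comment> \<open>\<open>p n\<close> is \<open>p\<^sub>h\<close> at level \<open>n + 1\<close>\<close>
      in \<tau> * (\<Sum>n=1..l.
           \<mu> * \<tau> / 2 * (L2_norm (lebesgue_on \<Omega>) (d_t \<tau> (\<lambda>k. strain (u k)) (n + 1)))\<^sup>2
         + 1 / \<mu>\<^sub>f * L2_inner (lebesgue_on \<Omega>) (\<lambda>x. K *v (grad (p n) x - \<rho>\<^sub>f x *\<^sub>R g x)) (grad (p n))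
         + \<kappa>\<^sub>2 * \<tau> / 2 * (L2_norm (lebesgue_on \<Omega>) (d_t \<tau> \<eta> (n + \<theta>)))\<^sup>2
         + \<kappa>\<^sub>3 * \<tau> / 2 * (L2_norm (lebesgue_on \<Omega>) (d_t \<tau> \<xi> (n + 1)))\<^sup>2
         - L2_inner (lebesgue_on \<Omega>) \<phi> (p n)
         - L2_inner (surface_measure \<Omega>) \<phi>\<^sub>1 (p n)
         - (1 - real \<theta>) * (\<kappa>\<^sub>1 * \<tau> / \<mu>\<^sub>f)
             * L2_inner (lebesgue_on \<Omega>) (\<lambda>x. K *v d_t \<tau> (\<lambda>k. grad (\<xi> k)) (n + 1) x) (grad (p n))))"

lemma L2_inner_scalar_permeability:
  fixes F G :: "'a \<Rightarrow> real^'d"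
  shows "L2_inner M (\<lambda>x. (k *\<^sub>R mat 1) *v F x) G = k * L2_inner M F G"
proof -
  have "(k *\<^sub>R mat 1) *v y = k *\<^sub>R y" for y :: "real^'d"
    by (metis matrix_vector_mul_lid scaleR_matrix_vector_assoc)
  then show ?thesis by (simp add: L2_inner_def)
qed

end

theory Submission
  imports Defs
begin

text \<open>The momentum equation of level \<open>n + 2\<close> is tested with \<open>u\<close> at the levels \<open>n + 2\<close> and \<open>n + 1\<close>,
  the constraint at both of these levels with \<open>\<xi> (n + 2)\<close>, and the diffusion equation of level
  \<open>n + 1 + \<theta>\<close> with the pressure of level \<open>n + 2\<close>. In the sum the divergence terms and the products
  of \<open>\<xi>\<close> with increments of \<open>\<eta>\<close> cancel, and the identity \<open>2a(a - b) = a\<^sup>2 - b\<^sup>2 + (a - b)\<^sup>2\<close> turns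
  the remaining terms into a telescoping energy difference plus the dissipation. Testing with the two
  levels separately, instead of with their difference, avoids splitting boundary integrals, so the
  finiteness of the surface measure is never an issue.\<close>

section \<open>Square-integrable functions\<close>

text \<open>The operator bound makes the square norm of \<open>f\<close> a dominating function. This
  covers scalar multiples and the action of the permeability matrix \<open>K\<close> on
  fluxes.\<close>

lemma square_integrable_bounded_linear:
  assumes "bounded_linear A" "square_integrable M f"
  shows "square_integrable M (\<lambda>x. A (f x))"
proof -
  interpret A: bounded_linear A by fact
  obtain B where B: "\<And>x. norm (A x) \<le> norm x * B" using A.bounded by blast
  have f: "f \<in> borel_measurable M" "integrable M (\<lambda>x. (norm (f x))\<^sup>2)"
    using assms(2) by (auto simp: square_integrable_def)
  have "A \<in> borel_measurable borel"
    by (intro borel_measurable_continuous_onI A.continuous_on continuous_on_id)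
  then have m: "(\<lambda>x. A (f x)) \<in> borel_measurable M"
    using f(1) by (rule measurable_compose_rev)
  have "norm ((norm (A (f x)))\<^sup>2) \<le> norm (B\<^sup>2 * (norm (f x))\<^sup>2)" for x
    using power_mono[OF B[of "f x"], of 2] by (simp add: power_mult_distrib mult.commute)
  then have "AE x in M. norm ((norm (A (f x)))\<^sup>2) \<le> norm (B\<^sup>2 * (norm (f x))\<^sup>2)" by (intro AE_I2)
  moreover have "integrable M (\<lambda>x. B\<^sup>2 * (norm (f x))\<^sup>2)" using f(2) by simp
  moreover have "(\<lambda>x. (norm (A (f x)))\<^sup>2) \<in> borel_measurable M" using m by measurable
  ultimately have "integrable M (\<lambda>x. (norm (A (f x)))\<^sup>2)"
    by (rule Bochner_Integration.integrable_bound[rotated 2])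
  then show ?thesis using m by (simp add: square_integrable_def)
qed

lemma square_integrable_scaleR:
  "square_integrable M f \<Longrightarrow> square_integrable M (\<lambda>x. c *\<^sub>R f x)"
  by (rule square_integrable_bounded_linear[OF bounded_linear_scaleR_right])

text \<open>The pointwise bound \<open>(a + b)^2 \<le> 2 * a^2 + 2 * b^2\<close> dominates the
  sum.\<close>

lemma square_integrable_add:
  assumes "square_integrable M f" "square_integrable M g"
  shows "square_integrable M (\<lambda>x. f x + g x)"
proof -
  have m: "f \<in> borel_measurable M" "g \<in> borel_measurable M"
    and i: "integrable M (\<lambda>x. (norm (f x))\<^sup>2)" "integrable M (\<lambda>x. (norm (g x))\<^sup>2)"
    using assms by (auto simp: square_integrable_def)
  have "norm ((norm (f x + g x))\<^sup>2) \<le> norm (2 * (norm (f x))\<^sup>2 + 2 * (norm (g x))\<^sup>2)" for x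
  proof -
    have "(norm (f x + g x))\<^sup>2 \<le> (norm (f x) + norm (g x))\<^sup>2"
      by (intro power_mono norm_triangle_ineq) auto
    also have "\<dots> \<le> 2 * (norm (f x))\<^sup>2 + 2 * (norm (g x))\<^sup>2"
      using sum_squares_bound[of "norm (f x)" "norm (g x)"] by (simp add: power2_sum)
    finally show ?thesis by simp
  qed
  then have "AE x in M. norm ((norm (f x + g x))\<^sup>2) \<le> norm (2 * (norm (f x))\<^sup>2 + 2 * (norm (g x))\<^sup>2)"
    by (intro AE_I2)
  moreover have "integrable M (\<lambda>x. 2 * (norm (f x))\<^sup>2 + 2 * (norm (g x))\<^sup>2)" using i by simp
  moreover have "(\<lambda>x. (norm (f x + g x))\<^sup>2) \<in> borel_measurable M" using m by measurable
  ultimately have "integrable M (\<lambda>x. (norm (f x + g x))\<^sup>2)"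
    by (rule Bochner_Integration.integrable_bound[rotated 2])
  then show ?thesis using m by (simp add: square_integrable_def)
qed

lemma square_integrable_diff:
  assumes "square_integrable M f" "square_integrable M g"
  shows "square_integrable M (\<lambda>x. f x - g x)"
  using square_integrable_add[OF assms(1) square_integrable_scaleR[OF assms(2), of "-1"]] by simp

lemma square_integrable_d_t:
  assumes "square_integrable M (w m)" "square_integrable M (w (m - 1))"
  shows "square_integrable M (d_t \<tau> w m)"
  unfolding d_t_def[abs_def] by (intro square_integrable_scaleR square_integrable_diff assms)

text \<open>Pointwise Cauchy-Schwarz and \<open>2 * a * b \<le> a^2 + b^2\<close> give the bound.
  The Bochner integral is additive only for integrable functions, so every splitting of
  \<open>L2_inner\<close> below rests on this.\<close>

lemma integrable_inner_square_integrable: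
  assumes "square_integrable M f" "square_integrable M g"
  shows "integrable M (\<lambda>x. f x \<bullet> g x)"
proof -
  have m: "f \<in> borel_measurable M" "g \<in> borel_measurable M"
    and i: "integrable M (\<lambda>x. (norm (f x))\<^sup>2)" "integrable M (\<lambda>x. (norm (g x))\<^sup>2)"
    using assms by (auto simp: square_integrable_def)
  have "norm (f x \<bullet> g x) \<le> norm ((norm (f x))\<^sup>2 + (norm (g x))\<^sup>2)" for x
  proof -
    have "\<bar>f x \<bullet> g x\<bar> \<le> norm (f x) * norm (g x)" by (rule Cauchy_Schwarz_ineq2)
    also have "\<dots> \<le> 2 * norm (f x) * norm (g x)" by simp
    also have "\<dots> \<le> (norm (f x))\<^sup>2 + (norm (g x))\<^sup>2" by (rule sum_squares_bound)
    finally show ?thesis by simp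
  qed
  then have "AE x in M. norm (f x \<bullet> g x) \<le> norm ((norm (f x))\<^sup>2 + (norm (g x))\<^sup>2)"
    by (intro AE_I2)
  moreover have "integrable M (\<lambda>x. (norm (f x))\<^sup>2 + (norm (g x))\<^sup>2)" using i by simp
  moreover have "(\<lambda>x. f x \<bullet> g x) \<in> borel_measurable M" using m by measurable
  ultimately show ?thesis
    by (rule Bochner_Integration.integrable_bound[rotated 2])
qed

section \<open>Bilinearity and polarization of the L2 inner product\<close>

lemma L2_inner_commute: "L2_inner M f g = L2_inner M g f"
  by (simp add: L2_inner_def inner_commute)

text \<open>A scalar leaves the Bochner integral unconditionally: for a nonintegrable integrand and
  a nonzero scalar, both sides are the default value 0.\<close>

lemma L2_inner_scaleR_left: "L2_inner M (\<lambda>x. c *\<^sub>R f x) g = c * L2_inner M f g"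
  by (simp add: L2_inner_def)

lemma L2_inner_add_left:
  assumes "square_integrable M f" "square_integrable M g" "square_integrable M k"
  shows "L2_inner M (\<lambda>x. f x + g x) k = L2_inner M f k + L2_inner M g k"
  using assms by (simp add: L2_inner_def inner_add_left integrable_inner_square_integrable)

lemma L2_inner_diff_left:
  assumes "square_integrable M f" "square_integrable M g" "square_integrable M k"
  shows "L2_inner M (\<lambda>x. f x - g x) k = L2_inner M f k - L2_inner M g k"
  using assms by (simp add: L2_inner_def inner_diff_left integrable_inner_square_integrable)

text \<open>This is the shape in which the pressure enters as a test function; on the reals
  \<open>*\<^sub>R\<close> is ordinary multiplication.\<close>

lemma L2_inner_lincomb_right:
  fixes f g k :: "'a \<Rightarrow> real"
  assumes "square_integrable M f" "square_integrable M g" "square_integrable M k"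
  shows "L2_inner M k (\<lambda>x. a * f x + b * g x) = a * L2_inner M k f + b * L2_inner M k g"
  using L2_inner_add_left[OF square_integrable_scaleR[OF assms(1), of a]
      square_integrable_scaleR[OF assms(2), of b] assms(3)]
    L2_inner_scaleR_left[of M a f k] L2_inner_scaleR_left[of M b g k]
  by (simp add: L2_inner_commute[of M k])

text \<open>For \<open>\<tau> = 0\<close> both sides vanish, since inversion and division by 0 give
  0.\<close>

lemma L2_inner_d_t_left:
  assumes "square_integrable M (w m)" "square_integrable M (w (m - 1))" "square_integrable M k"
  shows "L2_inner M (d_t \<tau> w m) k = (L2_inner M (w m) k - L2_inner M (w (m - 1)) k) / \<tau>"
  unfolding d_t_def[abs_def] L2_inner_scaleR_left L2_inner_diff_left[OF assms]
  by (simp add: divide_inverse)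

lemma L2_norm_power2: "(L2_norm M f)\<^sup>2 = L2_inner M f f"
  by (simp add: L2_norm_def L2_inner_def integral_nonneg_AE)

text \<open>With \<open>a = w m\<close> and \<open>b = w (m - 1)\<close> this is
  \<open>|a - b|^2 = 2 (a - b, a) - |a|^2 + |b|^2\<close>. The products are left against the newer
  level because the tested equations deliver them in that form; \<open>\<tau>\<^sup>2\<close> clears
  the difference quotient.\<close>

lemma L2_norm_d_t_polarization:
  assumes "\<tau> \<noteq> 0" "square_integrable M (w m)" "square_integrable M (w (m - 1))"
  shows "\<tau>\<^sup>2 * (L2_norm M (d_t \<tau> w m))\<^sup>2
    = 2 * (L2_inner M (w m) (w m) - L2_inner M (w (m - 1)) (w m))
      - (L2_norm M (w m))\<^sup>2 + (L2_norm M (w (m - 1)))\<^sup>2"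
proof -
  let ?d = "d_t \<tau> w m" and ?v = "w (m - 1)"
  have sq: "square_integrable M ?d" by (rule square_integrable_d_t[OF assms(2,3)])
  \<comment> \<open>The quotient is expanded in the left slot, the slots are swapped, and the other
    quotient is expanded, so linearity on the left suffices.\<close>
  have "\<tau>\<^sup>2 * L2_inner M ?d ?d = \<tau> * (L2_inner M (w m) ?d - L2_inner M ?v ?d)"
    using assms(1) unfolding L2_inner_d_t_left[OF assms(2,3) sq] by (simp add: power2_eq_square)
  also have "\<dots> = \<tau> * (L2_inner M ?d (w m) - L2_inner M ?d ?v)"
    by (simp only: L2_inner_commute[of M _ ?d])
  also have "\<dots> = L2_inner M (w m) (w m) - 2 * L2_inner M ?v (w m) + L2_inner M ?v ?v"
    using assms(1)
    unfolding L2_inner_d_t_left[OF assms(2,3,2)] L2_inner_d_t_left[OF assms(2,3,3)] L2_inner_commute[of M "w m" ?v]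
    by (simp add: right_diff_distrib diff_divide_distrib distrib_left)
  finally show ?thesis unfolding L2_norm_power2 by (simp only: algebra_simps)
qed


section \<open>Polynomials\<close>

text \<open>Continuity is asked for each fixed direction \<open>v\<close> only. This is enough,
  because a gradient evaluates the derivative at the finitely many axis vectors.\<close>

definition has_continuous_derivative :: "(real^'d \<Rightarrow> real) \<Rightarrow> (real^'d \<Rightarrow> real^'d \<Rightarrow> real) \<Rightarrow> bool" where
  "has_continuous_derivative p D \<longleftrightarrow>
     (\<forall>x. (p has_derivative D x) (at x)) \<and> (\<forall>v. continuous_on UNIV (\<lambda>x. D x v))"

lemma has_continuous_derivative_imp_continuous:
  "has_continuous_derivative p D \<Longrightarrow> continuous_on UNIV p"
  unfolding has_continuous_derivative_def
  by (metis continuous_at_imp_continuous_on has_derivative_continuous)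

lemma has_continuous_derivative_const: "has_continuous_derivative (\<lambda>x. c) (\<lambda>x v. 0)"
  by (simp add: has_continuous_derivative_def)

lemma has_continuous_derivative_nth: "has_continuous_derivative (\<lambda>x. x $ i) (\<lambda>x v. v $ i)"
  by (auto simp: has_continuous_derivative_def
      intro!: bounded_linear_imp_has_derivative bounded_linear_vec_nth)

lemma has_continuous_derivative_add:
  assumes "has_continuous_derivative p D" "has_continuous_derivative q E"
  shows "has_continuous_derivative (\<lambda>x. p x + q x) (\<lambda>x v. D x v + E x v)"
  using assms unfolding has_continuous_derivative_def
  by (auto intro!: has_derivative_add continuous_on_add)

lemma has_continuous_derivative_mult:
  assumes "has_continuous_derivative p D" "has_continuous_derivative q E"
  shows "has_continuous_derivative (\<lambda>x. p x * q x) (\<lambda>x v. p x * E x v + D x v * q x)"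
  using assms has_continuous_derivative_imp_continuous[OF assms(1)]
    has_continuous_derivative_imp_continuous[OF assms(2)]
  unfolding has_continuous_derivative_def
  by (auto intro!: has_derivative_mult continuous_on_add continuous_on_mult)

text \<open>Constants and coordinates have continuous derivatives, and sums and products preserve
  this; monomials and polynomials follow by induction, with no formula for the derivative.\<close>

lemma polynomial_le_has_continuous_derivative:
  assumes "polynomial_le k p"
  shows "\<exists>D. has_continuous_derivative p D"
proof -
  let ?C = "\<lambda>p :: real^'a \<Rightarrow> real. \<exists>D. has_continuous_derivative p D"
  have const: "?C (\<lambda>x. c)" for c using has_continuous_derivative_const by blast
  have add: "?C (\<lambda>x. p x + q x)" if "?C p" "?C q" for p q
    using has_continuous_derivative_add that by blast
  have mult: "?C (\<lambda>x. p x * q x)" if "?C p" "?C q" for p q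
    using has_continuous_derivative_mult that by blast
  have power: "?C (\<lambda>x. x $ i ^ n)" for i n
  proof (induction n)
    case 0
    show ?case using const[of 1] by simp
  next
    case (Suc n)
    have "?C (\<lambda>x. x $ i)" using has_continuous_derivative_nth by blast
    then show ?case unfolding power_Suc by (rule mult[OF _ Suc])
  qed
  have prod: "?C (\<lambda>x. \<Prod>i\<in>I. x $ i ^ a i)" for I and a :: "'a \<Rightarrow> nat"
  proof (induction I rule: infinite_finite_induct)
    case (insert i I)
    then show ?case unfolding prod.insert[OF insert(1,2)] by (intro mult[OF power])
  qed (use const[of 1] in simp_all)
  \<comment> \<open>The induction admits infinite \<open>S\<close>, where the sum is 0 and hence
    constant, so the set of exponents need not be counted.\<close>
  have sum: "?C (\<lambda>x. \<Sum>a\<in>S. c a * (\<Prod>i\<in>UNIV. x $ i ^ a i))" for S and c :: "('a \<Rightarrow> nat) \<Rightarrow> real"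
  proof (induction S rule: infinite_finite_induct)
    case (insert a S)
    then show ?case unfolding sum.insert[OF insert(1,2)] by (intro add[OF mult[OF const prod]])
  qed (use const[of 0] in simp_all)
  obtain c where "p = (\<lambda>x. \<Sum>a\<in>{a. sum a UNIV \<le> k}. c a * (\<Prod>i\<in>UNIV. x $ i ^ a i))"
    using assms unfolding polynomial_le_def by blast
  with sum show ?thesis by simp
qed

lemma polynomial_le_lincomb:
  assumes "polynomial_le k p" "polynomial_le k q"
  shows "polynomial_le k (\<lambda>x. a * p x + b * q x)"
proof -
  obtain c d where
    c: "\<And>x. p x = (\<Sum>m\<in>{m. sum m UNIV \<le> k}. c m * (\<Prod>i\<in>UNIV. x $ i ^ m i))" and
    d: "\<And>x. q x = (\<Sum>m\<in>{m. sum m UNIV \<le> k}. d m * (\<Prod>i\<in>UNIV. x $ i ^ m i))"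
    using assms unfolding polynomial_le_def by blast
  show ?thesis
    unfolding polynomial_le_def
    by (intro exI[of _ "\<lambda>m. a * c m + b * d m"])
      (simp add: c d sum_distrib_left sum.distrib distrib_right mult.assoc)
qed


section \<open>Finite element functions\<close>

text \<open>It makes the discrete pressure, a combination of \<open>\<xi>\<close> and
  \<open>\<eta>\<close>, an admissible test function in the diffusion equation.\<close>

lemma M_h_lincomb:
  assumes "\<phi> \<in> M_h \<Omega> \<T>" "\<psi> \<in> M_h \<Omega> \<T>"
  shows "(\<lambda>x. a * \<phi> x + b * \<psi> x) \<in> M_h \<Omega> \<T>"
proof -
  have "P_on 1 K (\<lambda>x. a * \<phi> x + b * \<psi> x)" if K: "K \<in> \<T>" for K
  proof -
    obtain p q where "polynomial_le 1 p" "polynomial_le 1 q" "\<forall>x\<in>K. \<phi> x = p x" "\<forall>x\<in>K. \<psi> x = q x"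
      using assms K unfolding M_h_def P_on_def by blast
    then show ?thesis
      unfolding P_on_def
      by (intro exI[of _ "\<lambda>x. a * p x + b * q x"]) (auto intro: polynomial_le_lincomb)
  qed
  then show ?thesis
    using assms by (auto simp: M_h_def intro!: continuous_intros)
qed

section \<open>Classical derivatives inside an element\<close>

text \<open>\<open>D\<close> is the derivative of the polynomial representing \<open>v\<close> on
  \<open>K\<close>. It is therefore continuous everywhere, in particular up to the boundary of
  \<open>K\<close>, although it is the derivative of \<open>v\<close> only in the interior.\<close>

lemma P_on_derivative:
  assumes "P_on k K v"
  obtains D where "\<And>x. x \<in> interior K \<Longrightarrow> (v has_derivative D x) (at x)"
    "\<And>h. continuous_on UNIV (\<lambda>x. D x h)"
proof -
  obtain p where "polynomial_le k p" and p: "\<forall>x\<in>K. v x = p x"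
    using assms unfolding P_on_def by blast
  then obtain D where D: "has_continuous_derivative p D"
    using polynomial_le_has_continuous_derivative by blast
  have "(v has_derivative D x) (at x)" if x: "x \<in> interior K" for x
  proof -
    have "(p has_derivative D x) (at x)" using D by (simp add: has_continuous_derivative_def)
    then show ?thesis
    proof (rule has_derivative_transform_within_open[OF _ open_interior x])
      fix y assume "y \<in> interior K"
      then have "y \<in> K" using interior_subset by (rule subsetD[rotated])
      then show "p y = v y" using p by simp
    qed
  qed
  moreover have "continuous_on UNIV (\<lambda>x. D x h)" for h
    using D by (simp add: has_continuous_derivative_def)
  ultimately show ?thesis by (rule that)
qed

lemma P_on_differentiable:
  assumes "P_on k K v" "x \<in> interior K"
  shows "v differentiable at x"
proof -
  obtain D where "\<And>x. x \<in> interior K \<Longrightarrow> (v has_derivative D x) (at x)"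
    by (rule P_on_derivative[OF assms(1)]) (rule that)
  then show ?thesis using assms(2) differentiableI by blast
qed

lemma grad_eq:
  "(w has_derivative D) (at x) \<Longrightarrow> grad w x = (\<chi> j. D (axis j 1))"
  unfolding grad_def by (drule frechet_derivative_at) simp

lemma grad_lincomb:
  assumes "\<phi> differentiable at x" "\<psi> differentiable at x"
  shows "grad (\<lambda>y. a * \<phi> y + b * \<psi> y) x = a *\<^sub>R grad \<phi> x + b *\<^sub>R grad \<psi> x"
proof -
  obtain D E where D: "(\<phi> has_derivative D) (at x)" and E: "(\<psi> has_derivative E) (at x)"
    using assms unfolding differentiable_def by blast
  have "((\<lambda>y. a * \<phi> y + b * \<psi> y) has_derivative (\<lambda>h. a * D h + b * E h)) (at x)"
    by (intro has_derivative_add has_derivative_mult_right D E)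
  from grad_eq[OF this] grad_eq[OF D] grad_eq[OF E] show ?thesis
    by (simp add: vec_eq_iff)
qed

lemma M_h_differentiable:
  assumes "\<phi> \<in> M_h \<Omega> \<T>" "K \<in> \<T>" "x \<in> interior K"
  shows "\<phi> differentiable at x"
  using assms P_on_differentiable[of 1 K \<phi> x] by (simp add: M_h_def)

text \<open>The extension \<open>G\<close> is continuous on all of \<open>K\<close>, hence bounded
  when \<open>K\<close> is compact. On the faces \<open>grad v\<close> itself may be an arbitrary
  value, as \<open>v\<close> need not be differentiable there.\<close>

lemma grad_piecewise_continuous:
  assumes "P_on k K v"
  shows "\<exists>G. continuous_on K G \<and> (\<forall>x\<in>interior K. grad v x = G x)"
proof -
  obtain D where D: "\<And>x. x \<in> interior K \<Longrightarrow> (v has_derivative D x) (at x)"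
    "\<And>h. continuous_on UNIV (\<lambda>x. D x h)"
    by (rule P_on_derivative[OF assms]) (rule that)
  show ?thesis
    by (intro exI[of _ "\<lambda>x. \<chi> j. D x (axis j 1)"])
      (auto simp: grad_eq D(1) intro!: continuous_on_vec_lambda continuous_on_subset[OF D(2)])
qed

text \<open>Componentwise derivatives assemble to a derivative of \<open>v\<close>, and uniqueness
  identifies it with \<open>frechet_derivative v\<close>. Strains thereby reduce to gradients of
  scalar components.\<close>

lemma jac_nth_grad:
  assumes "\<And>i. (\<lambda>x. v x $ i) differentiable at x"
  shows "jac v x $ i = grad (\<lambda>x. v x $ i) x"
proof -
  have c: "((\<lambda>x. v x $ i) has_derivative frechet_derivative (\<lambda>x. v x $ i) (at x)) (at x)" for i
    using assms frechet_derivative_works by blast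
  have "(v has_derivative (\<lambda>h. \<chi> i. frechet_derivative (\<lambda>x. v x $ i) (at x) h)) (at x)"
    by (subst has_derivative_componentwise_within)
      (auto simp: Basis_vec_def inner_axis intro: c)
  then have "frechet_derivative v (at x) = (\<lambda>h. \<chi> i. frechet_derivative (\<lambda>x. v x $ i) (at x) h)"
    by (metis frechet_derivative_at)
  then show ?thesis
    by (simp add: jac_def jacobian_def matrix_def grad_def)
qed

lemma strain_piecewise_continuous:
  assumes v: "\<And>i. P_on k K (\<lambda>x. v x $ i)"
  shows "\<exists>G. continuous_on K G \<and> (\<forall>x\<in>interior K. strain v x = G x)"
proof -
  have "\<forall>i. \<exists>G. continuous_on K G \<and> (\<forall>x\<in>interior K. grad (\<lambda>x. v x $ i) x = G x)"
    using grad_piecewise_continuous[OF v] by blast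
  then obtain G where G: "\<And>i. continuous_on K (G i)"
    "\<And>i x. x \<in> interior K \<Longrightarrow> grad (\<lambda>x. v x $ i) x = G i x"
    unfolding choice_iff by blast
  have "(\<lambda>x. v x $ i) differentiable at x" if "x \<in> interior K" for i x
    using v[of i] that by (rule P_on_differentiable)
  then have "jac v x = (\<chi> i. G i x)" if "x \<in> interior K" for x
    using that by (simp add: vec_eq_iff jac_nth_grad G(2))
  moreover have "continuous_on K (\<lambda>x. sym_part (\<chi> i. G i x))"
    unfolding sym_part_def transpose_def by (auto intro!: continuous_intros G(1))
  ultimately show ?thesis
    unfolding strain_def by (intro exI[of _ "\<lambda>x. sym_part (\<chi> i. G i x)"]) auto
qed

section \<open>Integrability over a meshed domain\<close>

text \<open>These are the properties of domain and mesh on which the measure theory rests: convexity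
  makes element boundaries null sets, compactness and finiteness give uniform bounds.\<close>

locale meshed_domain =
  fixes \<Omega> :: "(real^'d) set" and \<T> :: "(real^'d) set set"
  assumes open_domain: "open \<Omega>"
    and finite_mesh: "finite \<T>"
    and element: "\<And>K. K \<in> \<T> \<Longrightarrow> compact K \<and> convex K"
    and mesh_covers: "\<Union>\<T> = closure \<Omega>"
begin

lemma lmeasurable_domain: "\<Omega> \<in> lmeasurable"
proof -
  have "compact (\<Union>\<T>)" using finite_mesh element by (intro compact_Union) auto
  then have "bounded \<Omega>"
    using mesh_covers by (metis bounded_subset closure_subset compact_imp_bounded)
  then show ?thesis using open_domain by (metis interior_open lmeasurable_interior)
qed

sublocale finite_measure "lebesgue_on \<Omega>"
  using lmeasurable_domain by (rule finite_measure_lebesgue_on)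

definition skeleton :: "(real^'d) set" where
  "skeleton = (\<Union>K\<in>\<T>. frontier K)"

lemma negligible_skeleton: "negligible skeleton"
  unfolding skeleton_def using finite_mesh element
  by (intro negligible_Union) (auto intro: negligible_convex_frontier)

lemma in_element_interior:
  assumes "x \<in> \<Omega>" "x \<notin> skeleton"
  shows "\<exists>K\<in>\<T>. x \<in> interior K"
proof -
  obtain K where "K \<in> \<T>" "x \<in> K" using assms(1) mesh_covers closure_subset by blast
  moreover have "x \<notin> frontier K" using assms(2) \<open>K \<in> \<T>\<close> by (auto simp: skeleton_def)
  ultimately show ?thesis using closure_subset by (auto simp: frontier_def)
qed

text \<open>The element interiors exhaust the domain up to the null set \<open>skeleton\<close>, so
  almost-everywhere claims can be checked where finite element functions are differentiable.\<close>

lemma AE_elementI: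
  assumes "\<And>K x. K \<in> \<T> \<Longrightarrow> x \<in> interior K \<Longrightarrow> P x"
  shows "AE x in lebesgue_on \<Omega>. P x"
proof -
  have "AE x in lebesgue. x \<notin> skeleton"
    using negligible_skeleton by (intro AE_not_in) (simp add: negligible_iff_null_sets)
  then have "AE x in lebesgue. x \<in> \<Omega> \<longrightarrow> P x"
    by eventually_elim (use in_element_interior assms in blast)
  then show ?thesis
    using lmeasurable_domain by (subst AE_restrict_space_iff) auto
qed

text \<open>Such a function is measurable on each of finitely many pieces and bounded almost
  everywhere, and the domain has finite measure.\<close>

lemma piecewise_continuous_square_integrable:
  fixes f :: "real^'d \<Rightarrow> 'b::euclidean_space"
  assumes f: "\<And>K. K \<in> \<T> \<Longrightarrow> \<exists>G. continuous_on K G \<and> (\<forall>x\<in>interior K. f x = G x)"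
  shows "square_integrable (lebesgue_on \<Omega>) f"
proof -
  obtain G where G: "\<And>K. K \<in> \<T> \<Longrightarrow> continuous_on K (G K)"
    "\<And>K x. K \<in> \<T> \<Longrightarrow> x \<in> interior K \<Longrightarrow> f x = G K x"
    using f by metis
  have meas: "f \<in> borel_measurable (lebesgue_on \<Omega>)"
  proof (rule measurable_piecewise_restrict[where C = "insert skeleton (interior ` \<T>)"])
    show "countable (insert skeleton (interior ` \<T>))"
      using finite_mesh by (intro countable_finite) auto
    show "space (lebesgue_on \<Omega>) \<subseteq> \<Union> (insert skeleton (interior ` \<T>))"
      using in_element_interior by auto
    have \<Omega>: "\<Omega> \<in> sets lebesgue" using lmeasurable_domain by auto
    fix S assume S: "S \<in> insert skeleton (interior ` \<T>)"
    then have "S \<in> sets lebesgue"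
      using negligible_imp_sets[OF negligible_skeleton] by auto
    then show "S \<inter> space (lebesgue_on \<Omega>) \<in> sets (lebesgue_on \<Omega>)"
      using \<Omega> by (auto simp: sets_restrict_space)
    have r: "restrict_space (lebesgue_on \<Omega>) S = lebesgue_on (\<Omega> \<inter> S)"
      using \<Omega> \<open>S \<in> sets lebesgue\<close> by (intro restrict_restrict_space) auto
    show "f \<in> borel_measurable (restrict_space (lebesgue_on \<Omega>) S)"
    proof (cases "S = skeleton")
      case True
      \<comment> \<open>On the skeleton nothing is known about \<open>f\<close>, but Lebesgue
        measure is complete: every subset of this null set is measurable, hence so is every function
        on it.\<close>
      have sub: "A \<in> sets (lebesgue_on (\<Omega> \<inter> S))" if "A \<subseteq> \<Omega> \<inter> S" for A
      proof -
        have "negligible A"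
          using negligible_skeleton by (rule negligible_subset) (use that True in blast)
        then show ?thesis
          using that \<Omega> \<open>S \<in> sets lebesgue\<close> negligible_imp_sets
          by (subst sets_restrict_space_iff) auto
      qed
      then show ?thesis unfolding r by (intro measurableI sub) auto
    next
      case False
      then obtain K where K: "K \<in> \<T>" "S = interior K" using S by auto
      have "continuous_on (\<Omega> \<inter> S) (G K)"
        using G(1)[OF K(1)] by (rule continuous_on_subset) (use K interior_subset in auto)
      then have "continuous_on (\<Omega> \<inter> S) f"
        by (rule continuous_on_eq) (use G(2)[OF K(1)] K(2) in auto)
      then show ?thesis
        unfolding r using \<Omega> \<open>S \<in> sets lebesgue\<close>
        by (intro continuous_imp_measurable_on_sets_lebesgue) auto
    qed
  qed
  \<comment> \<open>Each \<open>G K\<close> is bounded on the compact \<open>K\<close>, and finitely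
    many elements share one bound; it passes to \<open>f\<close> off the skeleton.\<close>
  have "bounded (\<Union>K\<in>\<T>. G K ` K)"
    using finite_mesh element G(1)
    by (auto intro!: bounded_UN compact_imp_bounded compact_continuous_image)
  then obtain B where B: "\<And>K x. K \<in> \<T> \<Longrightarrow> x \<in> K \<Longrightarrow> norm (G K x) \<le> B"
    unfolding bounded_iff by blast
  have "AE x in lebesgue_on \<Omega>. norm ((norm (f x))\<^sup>2) \<le> B\<^sup>2"
  proof (rule AE_elementI)
    fix K x assume K: "K \<in> \<T>" "x \<in> interior K"
    then have "norm (f x) \<le> B" using G(2) B interior_subset by (metis subsetD)
    then show "norm ((norm (f x))\<^sup>2) \<le> B\<^sup>2" by (simp add: power_mono)
  qed
  then have "integrable (lebesgue_on \<Omega>) (\<lambda>x. (norm (f x))\<^sup>2)"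
    using meas by (intro integrable_const_bound) auto
  then show ?thesis using meas by (simp add: square_integrable_def)
qed

text \<open>The second function accommodates initial data such as \<open>\<eta> 0\<close>, which is
  prescribed by a formula on the closure only.\<close>

lemma continuous_square_integrable:
  assumes g: "continuous_on (closure \<Omega>) g" and eq: "\<And>x. x \<in> closure \<Omega> \<Longrightarrow> f x = g x"
  shows "square_integrable (lebesgue_on \<Omega>) f"
proof (rule piecewise_continuous_square_integrable)
  fix K assume "K \<in> \<T>"
  then have K: "K \<subseteq> closure \<Omega>" using mesh_covers by blast
  then show "\<exists>G. continuous_on K G \<and> (\<forall>x\<in>interior K. f x = G x)"
    using continuous_on_subset[OF g K] eq interior_subset by blast
qed

lemma M_h_square_integrable: "\<phi> \<in> M_h \<Omega> \<T> \<Longrightarrow> square_integrable (lebesgue_on \<Omega>) \<phi>"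
  by (rule continuous_square_integrable) (auto simp: M_h_def)

lemma grad_square_integrable:
  "\<phi> \<in> M_h \<Omega> \<T> \<Longrightarrow> square_integrable (lebesgue_on \<Omega>) (grad \<phi>)"
  by (intro piecewise_continuous_square_integrable grad_piecewise_continuous) (auto simp: M_h_def)

lemma strain_square_integrable:
  "v \<in> X_h \<Omega> \<T> \<Longrightarrow> square_integrable (lebesgue_on \<Omega>) (strain v)"
  by (intro piecewise_continuous_square_integrable strain_piecewise_continuous) (auto simp: X_h_def)

end

lemma mesh_meshed_domain:
  assumes "polygonal_domain \<Omega>" "mesh \<Omega> h \<T>"
  shows "meshed_domain \<Omega> \<T>"
proof
  show "open \<Omega>" using assms(1) by (auto simp: polygonal_domain_def)
  show "finite \<T>" "\<Union>\<T> = closure \<Omega>"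
    using assms(2) by (auto simp: mesh_def triangulation_def)
  fix K assume "K \<in> \<T>"
  then have "polytope K" using assms(2) simplex_imp_polytope by (auto simp: mesh_def)
  then show "compact K \<and> convex K" by (simp add: polytope_imp_compact polytope_imp_convex)
qed

text \<open>For \<open>\<theta> = 0\<close> the diffusion
  equation of level \<open>n\<close> is tested with the pressure of level \<open>n + 1\<close>, which combines \<open>\<xi>\<close> of level
  \<open>n + 1\<close> with \<open>\<eta>\<close> of level \<open>n\<close>; this produces the cross term.\<close>

lemma (in meshed_domain) diffusion_flux:
  fixes \<xi> \<eta> :: "nat \<Rightarrow> real^'d \<Rightarrow> real"
  assumes \<theta>: "\<theta> \<in> {0, 1}" and \<tau>: "\<tau> \<noteq> 0"
    and \<xi>: "\<xi> n \<in> M_h \<Omega> \<T>" "\<xi> (n + 1) \<in> M_h \<Omega> \<T>" and \<eta>: "\<eta> (n + \<theta>) \<in> M_h \<Omega> \<T>"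
    and b: "square_integrable (lebesgue_on \<Omega>) b"
    and \<psi>: "square_integrable (lebesgue_on \<Omega>) \<psi>"
  shows "L2_inner (lebesgue_on \<Omega>)
      (\<lambda>x. K *v (grad (\<lambda>y. \<kappa>\<^sub>1 * \<xi> (n + \<theta>) y + \<kappa>\<^sub>2 * \<eta> (n + \<theta>) y) x - b x)) \<psi>
    = L2_inner (lebesgue_on \<Omega>)
        (\<lambda>x. K *v (grad (\<lambda>y. \<kappa>\<^sub>1 * \<xi> (n + 1) y + \<kappa>\<^sub>2 * \<eta> (n + \<theta>) y) x - b x)) \<psi>
      - (1 - real \<theta>) * (\<kappa>\<^sub>1 * \<tau>) * L2_inner (lebesgue_on \<Omega>)
          (\<lambda>x. K *v d_t \<tau> (\<lambda>k. grad (\<xi> k)) (n + 1) x) \<psi>"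
\<comment> \<open>For \<open>\<theta> = 1\<close> the two pressures coincide and the cross term has
  factor 0; the closing \<open>simp\<close> settles this case.\<close>
proof (cases "\<theta> = 1")
  case False
  then have [simp]: "\<theta> = 0" using \<theta> by simp
  let ?p = "\<lambda>y. \<kappa>\<^sub>1 * \<xi> (n + 1) y + \<kappa>\<^sub>2 * \<eta> n y"
  let ?p' = "\<lambda>y. \<kappa>\<^sub>1 * \<xi> n y + \<kappa>\<^sub>2 * \<eta> n y"
  let ?d = "d_t \<tau> (\<lambda>k. grad (\<xi> k)) (n + 1)"
  have p: "?p \<in> M_h \<Omega> \<T>" and p': "?p' \<in> M_h \<Omega> \<T>"
    using \<xi> \<eta> by (auto intro!: M_h_lincomb)
  have K: "square_integrable (lebesgue_on \<Omega>) (\<lambda>x. K *v F x)"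
    if "square_integrable (lebesgue_on \<Omega>) F" for F :: "real^'d \<Rightarrow> real^'d"
    using matrix_vector_mul_bounded_linear that by (rule square_integrable_bounded_linear)
  have d: "square_integrable (lebesgue_on \<Omega>) ?d"
    using \<xi> by (intro square_integrable_d_t) (simp_all add: grad_square_integrable)
  have sq: "square_integrable (lebesgue_on \<Omega>) (\<lambda>x. K *v (grad ?p x - b x))"
    "square_integrable (lebesgue_on \<Omega>) (\<lambda>x. K *v (grad ?p' x - b x))"
    by (intro K square_integrable_diff grad_square_integrable p p' b)+
  \<comment> \<open>Linearity of \<open>grad\<close> needs differentiability of \<open>\<xi>\<close>
    and \<open>\<eta>\<close>, which holds inside the elements; hence an identity almost
    everywhere.\<close>
  have "AE x in lebesgue_on \<Omega>. (K *v (grad ?p' x - b x)) \<bullet> \<psi> x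
      = (K *v (grad ?p x - b x) - (\<kappa>\<^sub>1 * \<tau>) *\<^sub>R (K *v ?d x)) \<bullet> \<psi> x"
  proof (rule AE_elementI)
    fix E x assume E: "E \<in> \<T>" "x \<in> interior E"
    note diff = M_h_differentiable[OF _ E]
    \<comment> \<open>The older gradient of \<open>\<xi>\<close> is the newer one minus
      \<open>\<tau>\<close> times the difference quotient; \<open>\<tau> \<noteq> 0\<close> lets the
      step size cancel.\<close>
    have "grad ?p' x - b x = (grad ?p x - b x) - (\<kappa>\<^sub>1 * \<tau>) *\<^sub>R ?d x"
      using \<tau> \<xi> \<eta> by (simp add: grad_lincomb diff d_t_def algebra_simps)
    then show "(K *v (grad ?p' x - b x)) \<bullet> \<psi> x
      = (K *v (grad ?p x - b x) - (\<kappa>\<^sub>1 * \<tau>) *\<^sub>R (K *v ?d x)) \<bullet> \<psi> x"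
      by (simp only: matrix_vector_mult_diff_distrib matrix_vector_mult_scaleR)
  qed
  then have "L2_inner (lebesgue_on \<Omega>) (\<lambda>x. K *v (grad ?p' x - b x)) \<psi>
      = L2_inner (lebesgue_on \<Omega>) (\<lambda>x. K *v (grad ?p x - b x) - (\<kappa>\<^sub>1 * \<tau>) *\<^sub>R (K *v ?d x)) \<psi>"
    unfolding L2_inner_def
    by (intro integral_cong_AE borel_measurable_integrable integrable_inner_square_integrable
        square_integrable_diff square_integrable_scaleR sq K d \<psi>)
  also have "\<dots> = L2_inner (lebesgue_on \<Omega>) (\<lambda>x. K *v (grad ?p x - b x)) \<psi>
      - (\<kappa>\<^sub>1 * \<tau>) * L2_inner (lebesgue_on \<Omega>) (\<lambda>x. K *v ?d x) \<psi>"
    unfolding L2_inner_diff_left[OF sq(1) square_integrable_scaleR[OF K[OF d]] \<psi>]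
      L2_inner_scaleR_left ..
  finally show ?thesis by simp
qed simp


section \<open>The energy law\<close>

theorem lemma3p2:
  fixes \<Omega> :: "(real^'d) set"
    and lam \<mu> \<alpha> \<mu>\<^sub>f c\<^sub>0 \<kappa>\<^sub>1 \<kappa>\<^sub>2 \<kappa>\<^sub>3 :: real
    and K :: "real^'d^'d"
    and \<rho>\<^sub>f :: "real^'d \<Rightarrow> real" and g :: "real^'d \<Rightarrow> real^'d"
    and f f\<^sub>1 :: "real^'d \<Rightarrow> real^'d" and \<phi> \<phi>\<^sub>1 :: "real^'d \<Rightarrow> real"
    and u\<^sub>0 :: "real^'d \<Rightarrow> real^'d" and Du\<^sub>0 :: "real^'d \<Rightarrow> real^'d^'d" and p\<^sub>0 :: "real^'d \<Rightarrow> real"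
    and H :: "real set" and \<T> :: "real \<Rightarrow> (real^'d) set set" and h \<beta>\<^sub>0 :: real
    and \<tau> :: real and \<theta> l :: nat
    and u :: "nat \<Rightarrow> real^'d \<Rightarrow> real^'d" and \<xi> \<eta> p q :: "nat \<Rightarrow> real^'d \<Rightarrow> real"
  assumes dim: "CARD('d) = 2 \<or> CARD('d) = 3"
    and dom: "polygonal_domain \<Omega>"
    and params: "0 < lam" "0 < \<mu>" "0 < \<alpha>" "0 < \<mu>\<^sub>f" "0 \<le> c\<^sub>0"
    and kappa:
      "\<kappa>\<^sub>1 = \<alpha> / (\<alpha>\<^sup>2 + lam * c\<^sub>0)" "\<kappa>\<^sub>2 = lam / (\<alpha>\<^sup>2 + lam * c\<^sub>0)" "\<kappa>\<^sub>3 = c\<^sub>0 / (\<alpha>\<^sup>2 + lam * c\<^sub>0)"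
    and K: "transpose K = K" "\<And>z. z \<noteq> 0 \<Longrightarrow> 0 < z \<bullet> (K *v z)"
    and gravity: "\<exists>x\<in>\<Omega>. \<rho>\<^sub>f x \<noteq> 0" "square_integrable (lebesgue_on \<Omega>) (\<lambda>x. \<rho>\<^sub>f x *\<^sub>R g x)"
    and data:
      "square_integrable (lebesgue_on \<Omega>) f" "square_integrable (surface_measure \<Omega>) f\<^sub>1"
      "square_integrable (lebesgue_on \<Omega>) \<phi>" "square_integrable (surface_measure \<Omega>) \<phi>\<^sub>1"
      "H1_jacobian \<Omega> u\<^sub>0 Du\<^sub>0" "square_integrable (lebesgue_on \<Omega>) p\<^sub>0"
    and compatibility:
      "\<And>v. v \<in> rigid_motions \<Longrightarrow>
         L2_inner (lebesgue_on \<Omega>) f v + L2_inner (surface_measure \<Omega>) f\<^sub>1 v = 0"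
    and meshes: "\<And>h. h \<in> H \<Longrightarrow> 0 < h \<and> mesh \<Omega> h (\<T> h)" "quasi_uniform H \<T>"
    and inf_sup: "0 < \<beta>\<^sub>0" "\<And>h. h \<in> H \<Longrightarrow> inf_sup_stable \<Omega> (\<T> h) \<beta>\<^sub>0"
    and h: "h \<in> H"
    and step: "0 < \<tau>"
    and theta: "\<theta> \<in> {0, 1}"
    and initial:
      "is_elastic_projection \<Omega> (V_h \<Omega> (\<T> h)) Du\<^sub>0 (u 0)"
      "is_L2_projection \<Omega> (W_h \<Omega> (\<T> h)) p\<^sub>0 (p 0)"
      "is_L2_projection \<Omega> (W_h \<Omega> (\<T> h)) (\<lambda>x. trace (Du\<^sub>0 x)) (q 0)"
      "\<And>x. x \<in> closure \<Omega> \<Longrightarrow> \<eta> 0 x = c\<^sub>0 * p 0 x + \<alpha> * q 0 x"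
      "\<And>x. x \<in> closure \<Omega> \<Longrightarrow> \<xi> 0 x = \<alpha> * p 0 x - lam * q 0 x"
    and spaces:
      "\<And>n. u (n + 1) \<in> V_h \<Omega> (\<T> h)" "\<And>n. \<xi> (n + 1) \<in> W_h \<Omega> (\<T> h)" "\<And>n. \<eta> (n + 1) \<in> W_h \<Omega> (\<T> h)"
    and momentum: "\<And>n v. v \<in> V_h \<Omega> (\<T> h) \<Longrightarrow>
      \<mu> * L2_inner (lebesgue_on \<Omega>) (strain (u (n + 1))) (strain v)
        - L2_inner (lebesgue_on \<Omega>) (\<xi> (n + 1)) (divergence v)
      = L2_inner (lebesgue_on \<Omega>) f v + L2_inner (surface_measure \<Omega>) f\<^sub>1 v"
    and constraint: "\<And>n \<zeta>. \<zeta> \<in> M_h \<Omega> (\<T> h) \<Longrightarrow>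
      \<kappa>\<^sub>3 * L2_inner (lebesgue_on \<Omega>) (\<xi> (n + 1)) \<zeta>
        + L2_inner (lebesgue_on \<Omega>) (divergence (u (n + 1))) \<zeta>
      = \<kappa>\<^sub>1 * L2_inner (lebesgue_on \<Omega>) (\<eta> (n + \<theta>)) \<zeta>"
    and diffusion: "\<And>n \<psi>. \<psi> \<in> W_h \<Omega> (\<T> h) \<Longrightarrow>
      L2_inner (lebesgue_on \<Omega>) (d_t \<tau> \<eta> (n + 1)) \<psi>
        + 1 / \<mu>\<^sub>f * L2_inner (lebesgue_on \<Omega>)
            (\<lambda>x. K *v (grad (\<lambda>y. \<kappa>\<^sub>1 * \<xi> (n + 1) y + \<kappa>\<^sub>2 * \<eta> (n + 1) y) x - \<rho>\<^sub>f x *\<^sub>R g x)) (grad \<psi>)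
      = L2_inner (lebesgue_on \<Omega>) \<phi> \<psi> + L2_inner (surface_measure \<Omega>) \<phi>\<^sub>1 \<psi>"
    and updates:
      "\<And>n x. x \<in> closure \<Omega> \<Longrightarrow> p (n + 1) x = \<kappa>\<^sub>1 * \<xi> (n + 1) x + \<kappa>\<^sub>2 * \<eta> (n + \<theta>) x"
      "\<And>n x. x \<in> closure \<Omega> \<Longrightarrow> q (n + 1) x = \<kappa>\<^sub>1 * \<eta> (n + 1) x - \<kappa>\<^sub>3 * \<xi> (n + 1) x"
    and l: "1 \<le> l"
  shows "J_h \<Omega> \<mu> \<kappa>\<^sub>2 \<kappa>\<^sub>3 f f\<^sub>1 \<theta> u \<xi> \<eta> l
           + S_h \<Omega> \<mu> \<kappa>\<^sub>1 \<kappa>\<^sub>2 \<kappa>\<^sub>3 K \<mu>\<^sub>f \<rho>\<^sub>f g \<phi> \<phi>\<^sub>1 \<tau> \<theta> u \<xi> \<eta> l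
         = J_h \<Omega> \<mu> \<kappa>\<^sub>2 \<kappa>\<^sub>3 f f\<^sub>1 \<theta> u \<xi> \<eta> 0"
proof -
  interpret meshed_domain \<Omega> "\<T> h"
    using mesh_meshed_domain dom meshes(1) h by blast
  let ?I = "L2_inner (lebesgue_on \<Omega>)"
  let ?J = "J_h \<Omega> \<mu> \<kappa>\<^sub>2 \<kappa>\<^sub>3 f f\<^sub>1 \<theta> u \<xi> \<eta>"
  let ?S = "S_h \<Omega> \<mu> \<kappa>\<^sub>1 \<kappa>\<^sub>2 \<kappa>\<^sub>3 K \<mu>\<^sub>f \<rho>\<^sub>f g \<phi> \<phi>\<^sub>1 \<tau> \<theta> u \<xi> \<eta>"
  have u_sq: "square_integrable (lebesgue_on \<Omega>) (strain (u (n + 1)))" for n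
    using spaces(1)[of n] by (intro strain_square_integrable) (simp add: V_h_def)
  have \<xi>_sq: "square_integrable (lebesgue_on \<Omega>) (\<xi> (n + 1))" for n
    by (intro M_h_square_integrable spaces)
  \<comment> \<open>Level 0 of \<open>\<eta>\<close> enters the energy when
    \<open>\<theta> = 0\<close>, whereas \<open>u\<close> and \<open>\<xi>\<close> occur from level
    1 on.\<close>
  have "square_integrable (lebesgue_on \<Omega>) (\<eta> 0)"
    using initial(2-4) unfolding is_L2_projection_def M_h_def
    by (intro continuous_square_integrable[of "\<lambda>x. c\<^sub>0 * p 0 x + \<alpha> * q 0 x"])
      (auto intro!: continuous_intros)
  moreover have "square_integrable (lebesgue_on \<Omega>) (\<eta> (n + 1))" for n
    by (intro M_h_square_integrable spaces)
  ultimately have \<eta>_sq: "square_integrable (lebesgue_on \<Omega>) (\<eta> n)" for n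
    by (cases n) auto
  have step_law: "?J (n + 1) + ?S (n + 1) = ?J n + ?S n" for n
  proof -
    \<comment> \<open>This local \<open>p\<close> is the pressure of level \<open>n + 2\<close> and
      hides the given sequence, whose values are prescribed on the closure only; \<open>S_h\<close>
      is built from the same expression.\<close>
    define p where "p x = \<kappa>\<^sub>1 * \<xi> (n + 2) x + \<kappa>\<^sub>2 * \<eta> (n + 1 + \<theta>) x" for x
    have \<eta>_space: "\<eta> (n + 1 + \<theta>) \<in> M_h \<Omega> (\<T> h)" using spaces(3)[of "n + \<theta>"] by simp
    have p: "p \<in> M_h \<Omega> (\<T> h)"
      using spaces(2)[of "n + 1"] \<eta>_space unfolding p_def by (intro M_h_lincomb) simp_all
    define flux where "flux = ?I (\<lambda>x. K *v (grad p x - \<rho>\<^sub>f x *\<^sub>R g x)) (grad p)"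
    define cross where "cross = ?I (\<lambda>x. K *v d_t \<tau> (\<lambda>k. grad (\<xi> k)) (n + 2) x) (grad p)"
    define F where "F v = ?I f v + L2_inner (surface_measure \<Omega>) f\<^sub>1 v" for v
    define \<Phi> where "\<Phi> = ?I \<phi> p + L2_inner (surface_measure \<Omega>) \<phi>\<^sub>1 p"
    \<comment> \<open>The diffusion equation will be used with index \<open>n + \<theta>\<close>, so
      that its increment of \<open>\<eta>\<close> joins levels \<open>n + \<theta>\<close> and
      \<open>n + 1 + \<theta>\<close>, the two that occur in the constraints at levels
      \<open>n + 1\<close> and \<open>n + 2\<close>.\<close>
    have "L2_inner (lebesgue_on \<Omega>)
        (\<lambda>x. K *v (grad (\<lambda>y. \<kappa>\<^sub>1 * \<xi> (n + 1 + \<theta>) y + \<kappa>\<^sub>2 * \<eta> (n + 1 + \<theta>) y) x - \<rho>\<^sub>f x *\<^sub>R g x)) (grad p)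
      = flux - (1 - real \<theta>) * (\<kappa>\<^sub>1 * \<tau>) * cross"
      using diffusion_flux[OF theta, of \<tau> \<xi> "n + 1" \<eta> "\<lambda>x. \<rho>\<^sub>f x *\<^sub>R g x" "grad p" K \<kappa>\<^sub>1 \<kappa>\<^sub>2]
        step spaces(2)[of n] spaces(2)[of "n + 1"] \<eta>_space gravity(2) grad_square_integrable[OF p]
      by (simp add: flux_def cross_def p_def[abs_def])
    with diffusion[OF p, of "n + \<theta>"]
    have diff: "?I (d_t \<tau> \<eta> (n + 1 + \<theta>)) p + 1 / \<mu>\<^sub>f * (flux - (1 - real \<theta>) * (\<kappa>\<^sub>1 * \<tau>) * cross) = \<Phi>"
      by (simp add: \<Phi>_def)
    have \<xi>2: "square_integrable (lebesgue_on \<Omega>) (\<xi> (n + 2))" using \<xi>_sq[of "n + 1"] by simp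
    have "\<tau> * ?I (d_t \<tau> \<eta> (n + 1 + \<theta>)) p = ?I (\<eta> (n + 1 + \<theta>)) p - ?I (\<eta> (n + \<theta>)) p"
      using step L2_inner_d_t_left[of "lebesgue_on \<Omega>" \<eta> "n + 1 + \<theta>" p \<tau>]
      by (simp add: \<eta>_sq M_h_square_integrable[OF p])
    moreover have "?I (\<eta> m) p = \<kappa>\<^sub>1 * ?I (\<eta> m) (\<xi> (n + 2)) + \<kappa>\<^sub>2 * ?I (\<eta> m) (\<eta> (n + 1 + \<theta>))" for m
      unfolding p_def[abs_def] by (intro L2_inner_lincomb_right \<xi>2 \<eta>_sq)
    ultimately have time: "\<tau> * ?I (d_t \<tau> \<eta> (n + 1 + \<theta>)) p
      = \<kappa>\<^sub>1 * (?I (\<eta> (n + 1 + \<theta>)) (\<xi> (n + 2)) - ?I (\<eta> (n + \<theta>)) (\<xi> (n + 2)))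
        + \<kappa>\<^sub>2 * (?I (\<eta> (n + 1 + \<theta>)) (\<eta> (n + 1 + \<theta>)) - ?I (\<eta> (n + \<theta>)) (\<eta> (n + 1 + \<theta>)))"
      by (simp add: algebra_simps)
    have mom: "\<mu> * ?I (strain (u (n + 2))) (strain v) = ?I (\<xi> (n + 2)) (divergence v) + F v"
      if "v \<in> V_h \<Omega> (\<T> h)" for v
      using momentum[OF that, of "n + 1"] by (simp add: F_def)
    have mom2: "\<mu> * ?I (strain (u (n + 2))) (strain (u (n + 2)))
        = ?I (\<xi> (n + 2)) (divergence (u (n + 2))) + F (u (n + 2))"
      using spaces(1)[of "n + 1"] by (intro mom) simp
    have mom1: "\<mu> * ?I (strain (u (n + 1))) (strain (u (n + 2)))
        = ?I (\<xi> (n + 2)) (divergence (u (n + 1))) + F (u (n + 1))"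
      using mom[OF spaces(1)[of n]] by (simp add: L2_inner_commute)
    \<comment> \<open>Subtracting \<open>con1\<close> from \<open>con2\<close> turns the divergence
      increment into \<open>\<kappa>\<^sub>1\<close> times the increment of \<open>\<eta>\<close>
      against \<open>\<xi> (n + 2)\<close>, which also occurs in \<open>time\<close>. The divergence
      products stay single numbers whose factors are merely swapped.\<close>
    have con2: "?I (\<xi> (n + 2)) (divergence (u (n + 2)))
        = \<kappa>\<^sub>1 * ?I (\<eta> (n + 1 + \<theta>)) (\<xi> (n + 2)) - \<kappa>\<^sub>3 * ?I (\<xi> (n + 2)) (\<xi> (n + 2))"
      using constraint[OF spaces(2)[of "n + 1"], of "n + 1"]
      by (simp add: L2_inner_commute[of _ "\<xi> (n + 2)" "divergence _"] L2_inner_commute[of _ "divergence _"])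
    \<comment> \<open>The algorithm imposes the constraint from level 1 on; at \<open>n = 0\<close>
      this is its first instance, which is why the energy of index 0 contains \<open>u 1\<close> and
      \<open>\<xi> 1\<close>.\<close>
    have con1: "?I (\<xi> (n + 2)) (divergence (u (n + 1)))
        = \<kappa>\<^sub>1 * ?I (\<eta> (n + \<theta>)) (\<xi> (n + 2)) - \<kappa>\<^sub>3 * ?I (\<xi> (n + 1)) (\<xi> (n + 2))"
      using constraint[OF spaces(2)[of "n + 1"], of n]
      by (simp add: L2_inner_commute[of _ "divergence _"])
    have pu: "\<tau>\<^sup>2 * (L2_norm (lebesgue_on \<Omega>) (d_t \<tau> (\<lambda>k. strain (u k)) (n + 2)))\<^sup>2
      = 2 * (?I (strain (u (n + 2))) (strain (u (n + 2))) - ?I (strain (u (n + 1))) (strain (u (n + 2))))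
        - (L2_norm (lebesgue_on \<Omega>) (strain (u (n + 2))))\<^sup>2 + (L2_norm (lebesgue_on \<Omega>) (strain (u (n + 1))))\<^sup>2"
      using L2_norm_d_t_polarization[of \<tau> "lebesgue_on \<Omega>" "\<lambda>k. strain (u k)" "n + 2"]
        step u_sq[of n] u_sq[of "n + 1"] by simp
    have p\<xi>: "\<tau>\<^sup>2 * (L2_norm (lebesgue_on \<Omega>) (d_t \<tau> \<xi> (n + 2)))\<^sup>2
      = 2 * (?I (\<xi> (n + 2)) (\<xi> (n + 2)) - ?I (\<xi> (n + 1)) (\<xi> (n + 2)))
        - (L2_norm (lebesgue_on \<Omega>) (\<xi> (n + 2)))\<^sup>2 + (L2_norm (lebesgue_on \<Omega>) (\<xi> (n + 1)))\<^sup>2"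
      using L2_norm_d_t_polarization[of \<tau> "lebesgue_on \<Omega>" \<xi> "n + 2"] step \<xi>_sq[of n] \<xi>2 by simp
    have p\<eta>: "\<tau>\<^sup>2 * (L2_norm (lebesgue_on \<Omega>) (d_t \<tau> \<eta> (n + 1 + \<theta>)))\<^sup>2
      = 2 * (?I (\<eta> (n + 1 + \<theta>)) (\<eta> (n + 1 + \<theta>)) - ?I (\<eta> (n + \<theta>)) (\<eta> (n + 1 + \<theta>)))
        - (L2_norm (lebesgue_on \<Omega>) (\<eta> (n + 1 + \<theta>)))\<^sup>2 + (L2_norm (lebesgue_on \<Omega>) (\<eta> (n + \<theta>)))\<^sup>2"
      using L2_norm_d_t_polarization[of \<tau> "lebesgue_on \<Omega>" \<eta> "n + 1 + \<theta>"] step \<eta>_sq by simp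
    \<comment> \<open>The new summand is grouped so that the squared quotients match the
      polarization identities and the remaining bracket matches \<open>diff\<close>.\<close>
    have S: "?S (n + 1) = ?S n
        + \<mu> / 2 * (\<tau>\<^sup>2 * (L2_norm (lebesgue_on \<Omega>) (d_t \<tau> (\<lambda>k. strain (u k)) (n + 2)))\<^sup>2)
        + \<kappa>\<^sub>2 / 2 * (\<tau>\<^sup>2 * (L2_norm (lebesgue_on \<Omega>) (d_t \<tau> \<eta> (n + 1 + \<theta>)))\<^sup>2)
        + \<kappa>\<^sub>3 / 2 * (\<tau>\<^sup>2 * (L2_norm (lebesgue_on \<Omega>) (d_t \<tau> \<xi> (n + 2)))\<^sup>2)
        + \<tau> * (1 / \<mu>\<^sub>f * (flux - (1 - real \<theta>) * (\<kappa>\<^sub>1 * \<tau>) * cross) - \<Phi>)"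
      by (simp add: S_h_def Let_def flux_def cross_def \<Phi>_def p_def[abs_def] power2_eq_square algebra_simps
          diff_divide_distrib add_divide_distrib)
    have J: "?J (n + 1) - ?J n =
        \<mu> / 2 * ((L2_norm (lebesgue_on \<Omega>) (strain (u (n + 2))))\<^sup>2 - (L2_norm (lebesgue_on \<Omega>) (strain (u (n + 1))))\<^sup>2)
        + \<kappa>\<^sub>2 / 2 * ((L2_norm (lebesgue_on \<Omega>) (\<eta> (n + 1 + \<theta>)))\<^sup>2 - (L2_norm (lebesgue_on \<Omega>) (\<eta> (n + \<theta>)))\<^sup>2)
        + \<kappa>\<^sub>3 / 2 * ((L2_norm (lebesgue_on \<Omega>) (\<xi> (n + 2)))\<^sup>2 - (L2_norm (lebesgue_on \<Omega>) (\<xi> (n + 1)))\<^sup>2)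
        - F (u (n + 2)) + F (u (n + 1))"
      by (simp add: J_h_def F_def field_simps)
    have "\<tau> * (1 / \<mu>\<^sub>f * (flux - (1 - real \<theta>) * (\<kappa>\<^sub>1 * \<tau>) * cross) - \<Phi>)
        = - (\<tau> * ?I (d_t \<tau> \<eta> (n + 1 + \<theta>)) p)"
      unfolding diff[symmetric] by (simp add: algebra_simps)
    \<comment> \<open>Polarization cancels the squared norms in \<open>J\<close>. The momentum
      equations cancel the loads and leave divergence products, which the constraints and
      \<open>time\<close> eliminate together with the remaining \<open>\<xi>\<close> and
      \<open>\<eta>\<close> products.\<close>
    with S J mom2 mom1 con2 con1 time show ?thesis
      unfolding pu p\<xi> p\<eta> by (simp add: algebra_simps)
  qed
  have "?J m + ?S m = ?J 0" for m
  proof (induction m)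
    case 0
    show ?case by (simp add: S_h_def)
  next
    case (Suc m)
    then show ?case using step_law[of m] by simp
  qed
  then show ?thesis .
qed

end
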